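(* Let $\mathcal{G}$ be a connected metric graph with vertex set $\mathsf{V}$, edge set $\mathsf{E}$ and edge lengths $(\ell_{\mathsf{e}})_{\mathsf{e}\in\mathsf{E}}$, and let $\alpha\in\mathbb{R}^{\mathsf{V}}$ be such that the torsion function of $(\mathcal{G},\alpha)$ exists. Fix $\mathsf{e}_0\in\mathsf{E}$ and, for $s>0$, let $\mathcal{G}_s$ be the metric graph with the same topology as $\mathcal{G}$ and edge lengths $\ell_{s,\mathsf{e}_0}=s$ and $\ell_{s,\mathsf{e}}=\ell_{\mathsf{e}}$ for $\mathsf{e}\neq\mathsf{e}_0$. Denote the torsion function of $(\mathcal{G}_s,\alpha)$ by $\upsilon_s=(\upsilon_{s,\mathsf{e}})_{\mathsf{e}\in\mathsf{E}}$. Then there exists a neighborhood $U\subset(0,\infty)$ of $\ell_{\mathsf{e}_0}$ such that the map $U\ni s\mapsto T(\mathcal{G}_s,\alpha)$ is (well defined and) continuously differentiable, and its derivative at $s=\ell_{\mathsf{e}_0}$ is $$\frac{d}{ds}\bigg|_{s=\ell_{\mathsf{e}_0}}T(\mathcal{G}_s,\alpha)=2\upsilon_{s,\mathsf{e}_0}(x_0)+\upsilon_{s,\mathsf{e}_0}'(x_0)^2 ,$$ where the right-hand side is evaluated at $s=\ell_{\mathsf{e}_0}$ and $x_0$ is any element of $\mathsf{e}_0$; in particular, the right-hand side does not depend on the choice of $x_0\in\mathsf{e}_0$. Furthermore, if $\alpha\in[0,\infty)^{\mathsf{V}}$ and $\alpha$ is not identically zero, then $U=(0,\infty)$ is pos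sible.
   Context: A metric graph $\mathcal{G}$ is a finite collection of intervals glued together at their endpoints according to a finite combinatorial graph $(\mathsf{V},\mathsf{E})$ (loops and multiple edges allowed); each edge $\mathsf{e}\in\mathsf{E}$ is identified with $[0,\ell_{\mathsf{e}}]$, $\ell_{\mathsf{e}}\in(0,\infty)$. It is connected if any two points are joined by a continuous path. $\mathsf{E}_{\mathsf{v}}$ is the collection of edges incident to $\mathsf{v}$ (a loop at $\mathsf{v}$ counted twice, once for each endpoint), $u_{\mathsf{e}}$ is the restriction of $u$ to $\mathsf{e}$, and $\frac{\partial u_{\mathsf{e}}}{\partial n}(\mathsf{v})$ is the derivative of $u_{\mathsf{e}}$ at the endpoint $\mathsf{v}$ in the direction pointing into $\mathsf{v}$. For $\alpha\in\mathbb{R}^{\mathsf{V}}$, the operator $-\Delta_{\mathcal{G},\alpha}$ in $L^2(\mathcal{G})$ acts as $u\mapsto -u''$ on each edge, on functions that are edgewise in $H^2(0,\ell_{\mathsf{e}})$, continuous at every vertex, and satisfy $\sum_{\mathsf{e}\in\mathsf{E}_{\mathsf{v}}}\frac{\partial u_{\mathsf{e}}}{\partial n}(\mathsf{v})+\alpha_{\mathsf{v}}u(\mathsf{v})=0$ for all $\mathsf{v}\in\mathsf{V}$. The torsion function of $(\mathcal{G},\alpha)$ is the unique solution $\upsilon$ of $-\Delta_{\mathcal{G},\alpha}\upsilon=1$; it "exists" if this equation has a unique solution (no sign condition on $\upsilon$ is required). The torsional rigidity is $T(\mathcal{G},\alpha)=\int_{\mathcal{G}}\upsilon(x)\,\mathrm{d}x$.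 *)

theory Defs
  imports "HOL-Analysis.Analysis" "Graph_Theory.Digraph"
begin

section \<open>Metric graphs\<close>

text \<open>
  The combinatorial graph (loops and multiple edges allowed) is a finite digraph. The direction of
  an edge \<open>e\<close> only serves to fix the identification of \<open>e\<close> with \<open>[0, l e]\<close>: the tail is the
  endpoint \<open>0\<close> and the head is the endpoint \<open>l e\<close>.
\<close>

locale metric_graph = fin_digraph G for G :: "('v, 'e) pre_digraph" (structure) +
  fixes l :: "'e \<Rightarrow> real"
  assumes length_pos: "e \<in> arcs G \<Longrightarrow> 0 < l e"

datatype ('v, 'e) mg_point = Vertex 'v | Inner 'e real

definition mg_points :: "('v, 'e) pre_digraph \<Rightarrow> ('e \<Rightarrow> real) \<Rightarrow> ('v, 'e) mg_point set" where
  "mg_points G l = Vertex ` verts G \<union> {Inner e x | e x. e \<in> arcs G \<and> 0 < x \<and> x < l e}"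

definition glue ::
    "('v, 'e) pre_digraph \<Rightarrow> ('e \<Rightarrow> real) \<Rightarrow> 'e \<Rightarrow> real \<Rightarrow> ('v, 'e) mg_point" where
  "glue G l e x = (if x = 0 then Vertex (tail G e)
                   else if x = l e then Vertex (head G e) else Inner e x)"

text \<open>The quotient topology obtained from the disjoint union of the intervals \<open>[0, l e]\<close>.\<close>

definition mg_open :: "('v, 'e) pre_digraph \<Rightarrow> ('e \<Rightarrow> real) \<Rightarrow> ('v, 'e) mg_point set \<Rightarrow> bool" where
  "mg_open G l U \<longleftrightarrow> U \<subseteq> mg_points G l \<and>
     (\<forall>e\<in>arcs G. openin (top_of_set {0..l e}) {x \<in> {0..l e}. glue G l e x \<in> U})"

definition mg_topology :: "('v, 'e) pre_digraph \<Rightarrow> ('e \<Rightarrow> real) \<Rightarrow> ('v, 'e) mg_point topology" where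
  "mg_topology G l = topology (mg_open G l)"

lemma istopology_mg_open: "istopology (mg_open G l)"
  unfolding istopology_def
proof (intro conjI allI impI)
  fix S T assume S: "mg_open G l S" and T: "mg_open G l T"
  have "{x \<in> {0..l e}. glue G l e x \<in> S \<inter> T} =
        {x \<in> {0..l e}. glue G l e x \<in> S} \<inter> {x \<in> {0..l e}. glue G l e x \<in> T}" for e
    by auto
  with S T show "mg_open G l (S \<inter> T)"
    unfolding mg_open_def by (auto simp del: Int_iff intro!: openin_Int)
next
  fix K assume K: "\<forall>S\<in>K. mg_open G l S"
  have "{x \<in> {0..l e}. glue G l e x \<in> \<Union>K} = \<Union>((\<lambda>S. {x \<in> {0..l e}. glue G l e x \<in> S}) ` K)" for e
    by auto
  with K show "mg_open G l (\<Union>K)"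
    unfolding mg_open_def by (auto simp del: Union_iff UN_iff intro!: openin_Union)
qed

lemma openin_mg_topology: "openin (mg_topology G l) = mg_open G l"
  unfolding mg_topology_def by (rule topology_inverse'[OF istopology_mg_open])

lemma (in metric_graph) topspace_mg_topology: "topspace (mg_topology G l) = mg_points G l"
proof (rule antisym)
  show "topspace (mg_topology G l) \<subseteq> mg_points G l"
    using openin_topspace[of "mg_topology G l"] by (simp add: openin_mg_topology mg_open_def)
  have "glue G l e x \<in> mg_points G l" if "e \<in> arcs G" "x \<in> {0..l e}" for e x
    using that by (auto simp: glue_def mg_points_def)
  then have "{x \<in> {0..l e}. glue G l e x \<in> mg_points G l} = {0..l e}" if "e \<in> arcs G" for e
    using that by auto
  then have "mg_open G l (mg_points G l)"
    by (simp add: mg_open_def)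
  then show "mg_points G l \<subseteq> topspace (mg_topology G l)"
    by (simp add: openin_mg_topology[symmetric] openin_subset)
qed

definition connected_metric_graph :: "('v, 'e) pre_digraph \<Rightarrow> ('e \<Rightarrow> real) \<Rightarrow> bool" where
  "connected_metric_graph G l \<longleftrightarrow> metric_graph G l \<and> path_connected_space (mg_topology G l)"


section \<open>Sobolev functions on an interval\<close>

definition square_integrable_on :: "real set \<Rightarrow> (real \<Rightarrow> real) \<Rightarrow> bool" where
  "square_integrable_on S u \<longleftrightarrow>
     set_borel_measurable lebesgue S u \<and> set_integrable lebesgue S (\<lambda>x. (u x)\<^sup>2)"

definition test_function :: "real set \<Rightarrow> (real \<Rightarrow> real) \<Rightarrow> bool" where
  "test_function S \<phi> \<longleftrightarrow>
     (\<forall>n x. ((deriv ^^ n) \<phi>) differentiable (at x)) \<and>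
     compact (closure {x. \<phi> x \<noteq> 0}) \<and> closure {x. \<phi> x \<noteq> 0} \<subseteq> S"

text \<open>\<open>g\<close> is the \<open>k\<close>-th distributional derivative of \<open>u\<close> on the open set \<open>S\<close>; only used for
  square integrable \<open>u\<close> and \<open>g\<close>, so that both integrals exist.\<close>

definition weak_deriv :: "nat \<Rightarrow> real set \<Rightarrow> (real \<Rightarrow> real) \<Rightarrow> (real \<Rightarrow> real) \<Rightarrow> bool" where
  "weak_deriv k S u g \<longleftrightarrow>
     (\<forall>\<phi>. test_function S \<phi> \<longrightarrow>
        (LINT x:S|lebesgue. u x * (deriv ^^ k) \<phi> x) = (-1) ^ k * (LINT x:S|lebesgue. g x * \<phi> x))"

definition sobolev_H2 :: "real set \<Rightarrow> (real \<Rightarrow> real) \<Rightarrow> bool" where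
  "sobolev_H2 S u \<longleftrightarrow> square_integrable_on S u \<and>
     (\<forall>k\<in>{1, 2}. \<exists>g. square_integrable_on S g \<and> weak_deriv k S u g)"


section \<open>The Laplacian and the torsion function\<close>

text \<open>
  A function on the metric graph is a family \<open>u\<close> with \<open>u e\<close> its restriction to \<open>[0, l e]\<close>. Functions
  in the operator domain are represented by their representative that is continuous up to the
  endpoints (\<open>H\<^sup>2(0, l e)\<close> embeds into \<open>C\<^sup>1[0, l e]\<close>), extended by the dummy value \<open>0\<close> outside the
  edges, so that equality of families is equality of functions on the graph.
\<close>

definition edge_deriv :: "('e \<Rightarrow> real) \<Rightarrow> ('e \<Rightarrow> real \<Rightarrow> real) \<Rightarrow> 'e \<Rightarrow> real \<Rightarrow> real" where
  "edge_deriv l u e x = vector_derivative (u e) (at x within {0..l e})"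

text \<open>
  Sum over the edges incident to \<open>v\<close> of the derivatives pointing into \<open>v\<close>. A loop occurs in both
  sums, hence is counted once for each endpoint.
\<close>

definition normal_deriv_sum ::
    "('v, 'e) pre_digraph \<Rightarrow> ('e \<Rightarrow> real) \<Rightarrow> ('e \<Rightarrow> real \<Rightarrow> real) \<Rightarrow> 'v \<Rightarrow> real" where
  "normal_deriv_sum G l u v =
     (\<Sum>e\<in>{e \<in> arcs G. tail G e = v}. - edge_deriv l u e 0) +
     (\<Sum>e\<in>{e \<in> arcs G. head G e = v}. edge_deriv l u e (l e))"

text \<open>In the following definition \<open>c v\<close> is the common value \<open>u(v)\<close> of \<open>u\<close> at the vertex \<open>v\<close>.\<close>

definition laplacian_domain ::
    "('v, 'e) pre_digraph \<Rightarrow> ('e \<Rightarrow> real) \<Rightarrow> ('v \<Rightarrow> real) \<Rightarrow> ('e \<Rightarrow> real \<Rightarrow> real) set" where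
  "laplacian_domain G l \<alpha> = {u.
     (\<forall>e x. \<not> (e \<in> arcs G \<and> x \<in> {0..l e}) \<longrightarrow> u e x = 0) \<and>
     (\<forall>e\<in>arcs G. continuous_on {0..l e} (u e) \<and> sobolev_H2 {0<..<l e} (u e)) \<and>
     (\<exists>c. (\<forall>e\<in>arcs G. u e 0 = c (tail G e) \<and> u e (l e) = c (head G e)) \<and>
          (\<forall>v\<in>verts G. normal_deriv_sum G l u v + \<alpha> v * c v = 0))}"

text \<open>The graph of the operator: \<open>u\<close> lies in its domain and is mapped to (the class of) \<open>f\<close>.\<close>

definition neg_laplacian ::
    "('v, 'e) pre_digraph \<Rightarrow> ('e \<Rightarrow> real) \<Rightarrow> ('v \<Rightarrow> real) \<Rightarrow>
     ('e \<Rightarrow> real \<Rightarrow> real) \<Rightarrow> ('e \<Rightarrow> real \<Rightarrow> real) \<Rightarrow> bool" where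
  "neg_laplacian G l \<alpha> u f \<longleftrightarrow> u \<in> laplacian_domain G l \<alpha> \<and>
     (\<forall>e\<in>arcs G. square_integrable_on {0<..<l e} (f e) \<and>
                 weak_deriv 2 {0<..<l e} (u e) (\<lambda>x. - f e x))"

definition torsion_exists ::
    "('v, 'e) pre_digraph \<Rightarrow> ('e \<Rightarrow> real) \<Rightarrow> ('v \<Rightarrow> real) \<Rightarrow> bool" where
  "torsion_exists G l \<alpha> \<longleftrightarrow> (\<exists>!u. neg_laplacian G l \<alpha> u (\<lambda>_ _. 1))"

definition torsion ::
    "('v, 'e) pre_digraph \<Rightarrow> ('e \<Rightarrow> real) \<Rightarrow> ('v \<Rightarrow> real) \<Rightarrow> 'e \<Rightarrow> real \<Rightarrow> real" where
  "torsion G l \<alpha> = (THE u. neg_laplacian G l \<alpha> u (\<lambda>_ _. 1))"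

definition torsional_rigidity ::
    "('v, 'e) pre_digraph \<Rightarrow> ('e \<Rightarrow> real) \<Rightarrow> ('v \<Rightarrow> real) \<Rightarrow> real" where
  "torsional_rigidity G l \<alpha> = (\<Sum>e\<in>arcs G. LINT x:{0..l e}|lebesgue. torsion G l \<alpha> e x)"

definition rigidity_C1_on ::
    "('v, 'e) pre_digraph \<Rightarrow> ('e \<Rightarrow> real) \<Rightarrow> ('v \<Rightarrow> real) \<Rightarrow> 'e \<Rightarrow> real set \<Rightarrow> bool" where
  "rigidity_C1_on G l \<alpha> e0 U \<longleftrightarrow>
     (\<forall>s\<in>U. torsion_exists G (l(e0 := s)) \<alpha>) \<and>
     (\<lambda>s. torsional_rigidity G (l(e0 := s)) \<alpha>) C1_differentiable_on U"

end

theory Submission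
  imports Defs "HOL-Computational_Algebra.Polynomial" "Jordan_Normal_Form.Determinant"
begin

text \<open>
  A continuous function on \<open>[0, L]\<close> with weak second derivative \<open>-1\<close> is a quadratic polynomial, hence
  determined by its boundary values. So a torsion function amounts to a vector \<open>c\<close> of vertex values,
  and the vertex conditions become a symmetric linear system \<open>A c = b\<close>, where \<open>A\<close> is the weighted graph
  Laplacian (with weights \<open>1 / l e\<close>) plus the diagonal matrix of \<open>\<alpha>\<close>, and \<open>b\<close> collects half the lengths
  of the incident edges. The torsion function exists iff \<open>A\<close> is nonsingular, and the torsional
  rigidity is \<open>\<Sum>e. (l e)\<^sup>3 / 12\<close> plus the pairing of \<open>c\<close> with \<open>b\<close>. Varying the length of \<open>e0\<close> perturbs \<open>A\<close> by
  a matrix of rank one, so \<open>A\<close> stays nonsingular and \<open>c\<close> depends continuously on the length; by symmetry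
  of \<open>A\<close>, the difference quotient of the rigidity is an explicit expression in \<open>c\<close>. If \<open>\<alpha>\<close> is nonnegative
  and nonzero, \<open>A\<close> is positive definite for all lengths.
\<close>

section \<open>Smooth bumps\<close>

text \<open>Take \<open>z \<le> exp z\<close> at \<open>z = 1 / ((n + 1) * y)\<close>, raise it to
  the power \<open>n + 1\<close> and invert. Hence \<open>exp (- 1 / y)\<close> tends to 0 faster
  than any power of \<open>y\<close>.\<close>

lemma exp_minus_inverse_le:
  fixes y :: real
  assumes "0 < y"
  shows "exp (- 1 / y) \<le> (real (Suc n) * y) ^ Suc n"
proof -
  have "z \<le> exp z" for z :: real
    using exp_ge_add_one_self[of z] by linarith
  then have "(1 / (real (Suc n) * y)) ^ Suc n \<le> exp (1 / (real (Suc n) * y)) ^ Suc n"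
    using assms by (intro power_mono) auto
  also have "\<dots> = exp (1 / y)"
    using assms by (simp add: exp_of_nat_mult[symmetric] del: of_nat_Suc power_Suc)
  finally have "1 / (real (Suc n) * y) ^ Suc n \<le> exp (1 / y)"
    by (simp add: power_one_over del: of_nat_Suc power_Suc)
  then have "inverse (exp (1 / y)) \<le> inverse (1 / (real (Suc n) * y) ^ Suc n)"
    using assms by (intro le_imp_inverse_le) (auto simp del: of_nat_Suc power_Suc)
  then show ?thesis
    by (simp add: exp_minus del: of_nat_Suc power_Suc)
qed

text \<open>This family is closed under differentiation, so its members are smooth.\<close>

definition flat :: "real poly \<Rightarrow> real poly \<Rightarrow> nat \<Rightarrow> real \<Rightarrow> real" where
  "flat p q k x = (if poly q x > 0 then poly p x / poly q x ^ k * exp (- 1 / poly q x) else 0)"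

text \<open>Where \<open>q\<close> is positive this is the quotient and chain rule. At a point
  \<open>x\<close> with \<open>poly q x \<le> 0\<close> both the value and the derivative are 0,
  because the function is bounded by a multiple of \<open>poly p y\<close> times the square of
  \<open>poly q y - poly q x\<close>.\<close>

lemma flat_has_real_derivative:
  "(flat p q k has_real_derivative
     flat (pderiv p * q\<^sup>2 - of_nat k * p * q * pderiv q + p * pderiv q) q (k + 2) x) (at x)"
proof (cases "poly q x > 0")
  case True
  let ?h = "\<lambda>x. poly p x / poly q x ^ k * exp (- 1 / poly q x)"
  have "(?h has_real_derivative
      flat (pderiv p * q\<^sup>2 - of_nat k * p * q * pderiv q + p * pderiv q) q (k + 2) x) (at x)"
    using True
    apply (auto intro!: derivative_eq_intros poly_DERIV simp: flat_def)
    apply (cases k)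
     apply (auto simp: field_simps power2_eq_square power_add)
    done
  moreover have "open {y. poly q y > 0}"
    by (intro open_Collect_less continuous_intros)
  ultimately show ?thesis
    using True by (elim has_field_derivative_transform_within_open) (auto simp: flat_def)
next
  case False
  let ?C = "real (Suc (k+1)) ^ Suc (k+1)"
  have bound: "\<bar>flat p q k y\<bar> \<le> \<bar>poly p y\<bar> * ?C * (\<bar>poly q y - poly q x\<bar> * \<bar>poly q y - poly q x\<bar>)" for y
  proof (cases "poly q y > 0")
    case True
    \<comment> \<open>The exponent is \<open>k + 2\<close>: \<open>k\<close> factors cancel the
      denominator and two remain for the square.\<close>
    have "exp (- 1 / poly q y) \<le> (real (Suc (k+1)) * poly q y) ^ Suc (k+1)"
      by (rule exp_minus_inverse_le[OF True])
    also have "\<dots> = ?C * (poly q y ^ k * (poly q y)\<^sup>2)"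
      by (simp add: power_mult_distrib power2_eq_square mult_ac)
    finally have "\<bar>poly p y\<bar> / poly q y ^ k * exp (- 1 / poly q y)
        \<le> \<bar>poly p y\<bar> / poly q y ^ k * (?C * (poly q y ^ k * (poly q y)\<^sup>2))"
      using True by (intro mult_left_mono) auto
    also have "\<dots> = \<bar>poly p y\<bar> * ?C * (poly q y)\<^sup>2"
      using True by (simp add: field_simps)
    \<comment> \<open>Since \<open>poly q x \<le> 0 < poly q y\<close>, the value
      \<open>poly q y\<close> is at most the increment \<open>poly q y - poly q x\<close>.\<close>
    also have "\<dots> \<le> \<bar>poly p y\<bar> * ?C * (\<bar>poly q y - poly q x\<bar> * \<bar>poly q y - poly q x\<bar>)"
      unfolding power2_eq_square using True False by (intro mult_left_mono mult_mono) auto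
    finally show ?thesis
      using True by (simp add: flat_def abs_mult)
  qed (simp add: flat_def)
  have "((\<lambda>y. (flat p q k y - flat p q k x) / (y - x)) \<longlongrightarrow> 0) (at x)"
  proof (rule Lim_null_comparison)
    show "\<forall>\<^sub>F y in at x. norm ((flat p q k y - flat p q k x) / (y - x))
        \<le> \<bar>poly p y\<bar> * ?C * \<bar>poly q y - poly q x\<bar> * \<bar>(poly q y - poly q x) / (y - x)\<bar>"
    proof (rule always_eventually, rule allI)
      fix y
      have "norm ((flat p q k y - flat p q k x) / (y - x)) = \<bar>flat p q k y\<bar> / \<bar>y - x\<bar>"
        using False by (simp add: flat_def[of _ _ _ x] abs_divide)
      also have "\<dots> \<le> \<bar>poly p y\<bar> * ?C * (\<bar>poly q y - poly q x\<bar> * \<bar>poly q y - poly q x\<bar>) / \<bar>y - x\<bar>"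
        by (intro divide_right_mono bound) auto
      finally show "norm ((flat p q k y - flat p q k x) / (y - x))
        \<le> \<bar>poly p y\<bar> * ?C * \<bar>poly q y - poly q x\<bar> * \<bar>(poly q y - poly q x) / (y - x)\<bar>"
        by (simp add: abs_divide mult_ac del: abs_mult_self_eq)
    qed
    have "(poly q has_real_derivative poly (pderiv q) x) (at x)"
      by (rule poly_DERIV)
    then have "((\<lambda>y. (poly q y - poly q x) / (y - x)) \<longlongrightarrow> poly (pderiv q) x) (at x)"
      by (simp add: has_field_derivative_iff)
    then have "((\<lambda>y. \<bar>poly p y\<bar> * ?C * \<bar>poly q y - poly q x\<bar> * \<bar>(poly q y - poly q x) / (y - x)\<bar>)
      \<longlongrightarrow> \<bar>poly p x\<bar> * ?C * \<bar>poly q x - poly q x\<bar> * \<bar>poly (pderiv q) x\<bar>) (at x)"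
      by (intro tendsto_intros) auto
    then show "((\<lambda>y. \<bar>poly p y\<bar> * ?C * \<bar>poly q y - poly q x\<bar> * \<bar>(poly q y - poly q x) / (y - x)\<bar>)
      \<longlongrightarrow> 0) (at x)"
      by simp
  qed
  moreover have "flat p' q k' x = 0" for p' k'
    using False by (simp add: flat_def)
  ultimately show ?thesis
    unfolding has_field_derivative_iff by metis
qed

lemma funpow_deriv_flat: "\<exists>p' k'. (deriv ^^ n) (flat p q k) = flat p' q k'"
proof (induction n)
  case (Suc n)
  then obtain p' k' where "(deriv ^^ n) (flat p q k) = flat p' q k'"
    by blast
  moreover have "\<exists>p'' k''. deriv (flat p' q k') = flat p'' q k''"
    using DERIV_imp_deriv[OF flat_has_real_derivative] by (intro exI ext)
  ultimately show ?case
    by simp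
qed auto

lemma flat_smooth: "(deriv ^^ n) (flat p q k) differentiable (at x)"
proof -
  obtain p' k' where "(deriv ^^ n) (flat p q k) = flat p' q k'"
    using funpow_deriv_flat by blast
  then show ?thesis
    using real_differentiable_def flat_has_real_derivative by metis
qed

section \<open>Bumps and their double antiderivatives\<close>

lemma global_antiderivative:
  fixes f :: "real \<Rightarrow> real"
  assumes "continuous_on UNIV f"
  obtains F where "\<And>x. (F has_real_derivative f x) (at x)"
proof -
  have "\<exists>F. \<forall>x::real. -\<infinity> < ereal x \<longrightarrow> ereal x < \<infinity> \<longrightarrow> (F has_vector_derivative f x) (at x)"
    using assms by (intro einterval_antiderivative) (auto simp: continuous_on_eq_continuous_at)
  then show ?thesis
    using that by (auto simp: has_real_derivative_iff_has_vector_derivative)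
qed

lemma deriv_zero_imp_eq:
  fixes f :: "real \<Rightarrow> real"
  assumes "\<And>z. (f has_real_derivative f' z) (at z)" and "\<And>z. z \<in> {x..y} \<Longrightarrow> f' z = 0" and "x \<le> y"
  shows "f x = f y"
proof (cases "x = y")
  case False
  then have "x < y"
    using assms by auto
  then obtain z where "z > x" "z < y" "f y - f x = (y - x) * f' z"
    using MVT2[of x y f f'] assms(1) by blast
  then show ?thesis
    using assms(2)[of z] by auto
qed auto

text \<open>\<open>H\<close> is the double antiderivative of the bump that vanishes on the left. Its
  slope \<open>H1\<close> is constant beyond \<open>\<epsilon>\<close>, so \<open>H\<close> is
  affine there; this allows suitable combinations of translates of \<open>H\<close> to cancel on
  both sides.\<close>

lemma obtain_bump:
  fixes \<epsilon> :: real
  assumes "0 < \<epsilon>"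
  obtains \<eta> H1 H \<kappa> c where
    "\<And>n x. (deriv ^^ n) \<eta> differentiable (at x)"
    "\<And>x. 0 \<le> \<eta> x" "0 < \<eta> 0" "\<And>x. \<epsilon> \<le> \<bar>x\<bar> \<Longrightarrow> \<eta> x = 0"
    "\<And>x. (H has_real_derivative H1 x) (at x)" "\<And>x. (H1 has_real_derivative \<eta> x) (at x)"
    "\<And>x. x \<le> - \<epsilon> \<Longrightarrow> H x = 0" "\<And>x. \<epsilon> \<le> x \<Longrightarrow> H x = \<kappa> * x + c"
proof -
  \<comment> \<open>The polynomial is \<open>\<epsilon>\<^sup>2 - x\<^sup>2\<close>, which is
    positive exactly between \<open>-\<epsilon>\<close> and \<open>\<epsilon>\<close>.\<close>
  define \<eta> where "\<eta> = flat 1 [:\<epsilon>\<^sup>2, 0, -1:] 0"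
  have \<eta>_eq: "\<eta> x = (if \<epsilon>\<^sup>2 - x\<^sup>2 > 0 then exp (- 1 / (\<epsilon>\<^sup>2 - x\<^sup>2)) else 0)" for x
    by (simp add: \<eta>_def flat_def power2_eq_square)
  have smooth: "(deriv ^^ n) \<eta> differentiable (at x)" for n x
    unfolding \<eta>_def by (rule flat_smooth)
  have zero: "\<eta> x = 0" if "\<epsilon> \<le> \<bar>x\<bar>" for x
    using that assms power_mono[of \<epsilon> "\<bar>x\<bar>" 2] by (simp add: \<eta>_eq)
  have "continuous_on UNIV \<eta>"
    using smooth[of 0] by (simp add: continuous_on_eq_continuous_at differentiable_imp_continuous_within)
  then obtain F where F: "\<And>x. (F has_real_derivative \<eta> x) (at x)"
    using global_antiderivative by blast
  define H1 where "H1 x = F x - F (- \<epsilon>)" for x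
  have H1: "(H1 has_real_derivative \<eta> x) (at x)" for x
    unfolding H1_def by (auto intro!: derivative_eq_intros F)
  have H1_left: "H1 x = 0" if "x \<le> - \<epsilon>" for x
    using deriv_zero_imp_eq[OF F, of x "- \<epsilon>"] that zero assms by (auto simp: H1_def)
  have H1_right: "H1 x = H1 \<epsilon>" if "\<epsilon> \<le> x" for x
    using deriv_zero_imp_eq[OF H1, of \<epsilon> x] that zero assms by auto
  have "continuous_on UNIV H1"
    using H1 by (meson DERIV_isCont continuous_at_imp_continuous_on)
  then obtain K where K: "\<And>x. (K has_real_derivative H1 x) (at x)"
    using global_antiderivative by blast
  define H where "H x = K x - K (- \<epsilon>)" for x
  have H: "(H has_real_derivative H1 x) (at x)" for x
    unfolding H_def by (auto intro!: derivative_eq_intros K)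
  have H_left: "H x = 0" if "x \<le> - \<epsilon>" for x
    using deriv_zero_imp_eq[OF K, of x "- \<epsilon>"] that H1_left by (auto simp: H_def)
  \<comment> \<open>Subtracting the line of slope \<open>H1 \<epsilon>\<close> leaves a function
    whose derivative is 0 to the right of \<open>\<epsilon>\<close>.\<close>
  have "((\<lambda>x. H x - H1 \<epsilon> * x) has_real_derivative H1 z - H1 \<epsilon>) (at z)" for z
    by (auto intro!: derivative_eq_intros H)
  then have "H \<epsilon> - H1 \<epsilon> * \<epsilon> = H x - H1 \<epsilon> * x" if "\<epsilon> \<le> x" for x
    by (rule deriv_zero_imp_eq[OF _ _ that]) (metis H1_right atLeastAtMost_iff diff_self)
  then have H_right: "H x = H1 \<epsilon> * x + (H \<epsilon> - H1 \<epsilon> * \<epsilon>)" if "\<epsilon> \<le> x" for x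
    using that by (simp add: algebra_simps)
  show thesis
  proof (rule that[of \<eta> H H1 "H1 \<epsilon>" "H \<epsilon> - H1 \<epsilon> * \<epsilon>"])
    show "0 \<le> \<eta> x" for x
      by (simp add: \<eta>_eq)
    show "0 < \<eta> 0"
      using assms by (simp add: \<eta>_eq)
  qed (fact smooth zero H H1 H_left H_right)+
qed

section \<open>Weak derivatives\<close>

lemma set_integrable_Ioo_continuous:
  fixes f :: "real \<Rightarrow> real"
  assumes "continuous_on {a..b} f"
  shows "set_integrable lebesgue {a<..<b} f"
  using absolutely_integrable_continuous_real[OF assms]
  by (rule set_integrable_subset) auto

lemma LINT_Ioo_continuous:
  fixes f :: "real \<Rightarrow> real"
  assumes "continuous_on {a..b} f"
  shows "(LINT x:{a<..<b}|lebesgue. f x) = integral {a..b} f"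
  using set_lebesgue_integral_eq_integral(2)[OF set_integrable_Ioo_continuous[OF assms]]
  by (simp add: integral_open_interval_real)

lemma square_integrable_on_continuous:
  assumes "continuous_on {a..b} u"
  shows "square_integrable_on {a<..<b} u"
  using set_integrable_Ioo_continuous[OF assms]
    set_integrable_Ioo_continuous[of a b "\<lambda>x. (u x)\<^sup>2"] assms
  unfolding square_integrable_on_def set_integrable_def set_borel_measurable_def
  by (auto intro!: continuous_intros)

lemma smooth_has_real_derivative:
  assumes "\<And>n x. (deriv ^^ n) \<phi> differentiable (at x)"
  shows "((deriv ^^ n) \<phi> has_real_derivative (deriv ^^ Suc n) \<phi> x) (at (x::real))"
  using assms[of n x] by (simp add: DERIV_deriv_iff_real_differentiable)

lemma test_function_has_real_derivative:
  assumes "test_function S \<phi>"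
  shows "((deriv ^^ n) \<phi> has_real_derivative (deriv ^^ Suc n) \<phi> x) (at x)"
  using assms by (intro smooth_has_real_derivative) (auto simp: test_function_def)

lemma test_function_continuous_on:
  assumes "test_function S \<phi>"
  shows "continuous_on T ((deriv ^^ n) \<phi>)"
  using test_function_has_real_derivative[OF assms]
  by (meson DERIV_isCont continuous_at_imp_continuous_on)

text \<open>The complement of the closed support is open and \<open>\<phi>\<close> is 0 on it, so by
  induction all derivatives are 0 on it as well.\<close>

lemma test_function_eq_0:
  assumes "test_function S \<phi>" "x \<notin> S"
  shows "(deriv ^^ n) \<phi> x = 0"
proof -
  let ?U = "- closure {x. \<phi> x \<noteq> 0}"
  have "\<forall>x\<in>?U. (deriv ^^ n) \<phi> x = 0"
  proof (induction n)
    case 0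
    then show ?case
      using closure_subset[of "{x. \<phi> x \<noteq> 0}"] by auto
  next
    case (Suc n)
    show ?case
    proof
      fix x assume x: "x \<in> ?U"
      have "((\<lambda>_. 0) has_real_derivative 0) (at x)"
        by simp
      then have "((deriv ^^ n) \<phi> has_real_derivative 0) (at x)"
        by (rule has_field_derivative_transform_within_open[OF _ _ x]) (use Suc in auto)
      then show "(deriv ^^ Suc n) \<phi> x = 0"
        using test_function_has_real_derivative[OF assms(1)] DERIV_unique by blast
    qed
  qed
  then show ?thesis
    using assms by (auto simp: test_function_def)
qed

lemma weak_deriv_cong:
  assumes "S \<in> sets lebesgue" and "\<And>x. x \<in> S \<Longrightarrow> u x = v x"
  shows "weak_deriv k S u g \<longleftrightarrow> weak_deriv k S v g"
proof -
  have "(LINT x:S|lebesgue. u x * f x) = (LINT x:S|lebesgue. v x * f x)" for f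
    using assms by (intro set_lebesgue_integral_cong) auto
  then show ?thesis
    by (simp add: weak_deriv_def)
qed

lemma square_integrable_on_cong:
  assumes "\<And>x. x \<in> S \<Longrightarrow> u x = v x"
  shows "square_integrable_on S u \<longleftrightarrow> square_integrable_on S v"
proof -
  have "(\<lambda>x. indicator S x *\<^sub>R f (u x)) = (\<lambda>x. indicator S x *\<^sub>R f (v x))" for f :: "real \<Rightarrow> real"
    using assms by (auto simp: indicator_def)
  from this[of "\<lambda>x. x"] this[of "\<lambda>x. x\<^sup>2"] show ?thesis
    unfolding square_integrable_on_def set_borel_measurable_def set_integrable_def by metis
qed

text \<open>Integration by parts; the boundary terms vanish because the test function is 0 at
  \<open>a\<close> and \<open>b\<close>.\<close>

lemma weak_deriv_1_classical:
  fixes u u' :: "real \<Rightarrow> real"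
  assumes "a \<le> b" and u: "\<And>x. (u has_real_derivative u' x) (at x)" and u': "continuous_on {a..b} u'"
  shows "weak_deriv 1 {a<..<b} u u'"
  unfolding weak_deriv_def
proof (intro allI impI)
  fix \<phi> assume \<phi>: "test_function {a<..<b} \<phi>"
  note d = test_function_has_real_derivative[OF \<phi>] and c = test_function_continuous_on[OF \<phi>]
  have cu: "continuous_on {a..b} u"
    using u by (meson DERIV_isCont continuous_at_imp_continuous_on)
  have "((\<lambda>x. u x * deriv \<phi> x + u' x * \<phi> x) has_integral (u b * \<phi> b - u a * \<phi> a)) {a..b}"
  proof (rule fundamental_theorem_of_calculus[OF assms(1)])
    fix x
    have "((\<lambda>x. u x * \<phi> x) has_real_derivative u x * deriv \<phi> x + u' x * \<phi> x) (at x)"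
      using d[of 0] by (auto intro!: derivative_eq_intros u)
    then show "((\<lambda>x. u x * \<phi> x) has_vector_derivative u x * deriv \<phi> x + u' x * \<phi> x)
        (at x within {a..b})"
      by (simp add: has_real_derivative_iff_has_vector_derivative has_vector_derivative_at_within)
  qed
  moreover have "\<phi> a = 0" "\<phi> b = 0"
    using test_function_eq_0[OF \<phi>, of _ 0] by auto
  ultimately have "integral {a..b} (\<lambda>x. u x * deriv \<phi> x + u' x * \<phi> x) = 0"
    by (simp add: integral_unique)
  moreover have "continuous_on {a..b} (\<lambda>x. u x * deriv \<phi> x)" "continuous_on {a..b} (\<lambda>x. u' x * \<phi> x)"
    using c[of _ 0] c[of _ 1] cu u' by (auto intro!: continuous_intros)
  ultimately show "(LINT x:{a<..<b}|lebesgue. u x * (deriv ^^ 1) \<phi> x) =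
      (- 1) ^ 1 * (LINT x:{a<..<b}|lebesgue. u' x * \<phi> x)"
    by (simp add: LINT_Ioo_continuous integral_add integrable_continuous_real)
qed

lemma test_function_deriv:
  assumes "test_function S \<phi>"
  shows "test_function S (deriv \<phi>)"
proof -
  have "(deriv ^^ n) (deriv \<phi>) differentiable (at x)" for n x
    using assms[unfolded test_function_def, THEN conjunct1, rule_format, of "Suc n" x]
    by (simp add: funpow_Suc_right del: funpow.simps)
  moreover have "{x. deriv \<phi> x \<noteq> 0} \<subseteq> closure {x. \<phi> x \<noteq> 0}"
  proof -
    \<comment> \<open>Regarding \<open>\<phi>\<close> as a test function on its own closed support
      lets \<open>test_function_eq_0\<close> locate the support of the derivative.\<close>
    have "test_function (closure {x. \<phi> x \<noteq> 0}) \<phi>"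
      using assms by (simp add: test_function_def)
    from test_function_eq_0[OF this, of _ 1] show ?thesis
      by auto
  qed
  then have "closure {x. deriv \<phi> x \<noteq> 0} \<subseteq> closure {x. \<phi> x \<noteq> 0}"
    by (simp add: closure_minimal)
  moreover from this have "compact (closure {x. deriv \<phi> x \<noteq> 0})"
    using assms compact_Int_closed[of "closure {x. \<phi> x \<noteq> 0}" "closure {x. deriv \<phi> x \<noteq> 0}"]
    by (simp add: Int_absorb1 test_function_def)
  ultimately show ?thesis
    using assms unfolding test_function_def by blast
qed

text \<open>The first-order rule is used twice: for \<open>u\<close> with
  \<open>deriv \<phi>\<close> as test function, then for \<open>u'\<close> with
  \<open>\<phi>\<close>.\<close>

lemma weak_deriv_2_classical:
  fixes u u' u'' :: "real \<Rightarrow> real"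
  assumes "a \<le> b" and u: "\<And>x. (u has_real_derivative u' x) (at x)"
    and u': "\<And>x. (u' has_real_derivative u'' x) (at x)" and u'': "continuous_on {a..b} u''"
  shows "weak_deriv 2 {a<..<b} u u''"
  unfolding weak_deriv_def
proof (intro allI impI)
  fix \<phi> assume \<phi>: "test_function {a<..<b} \<phi>"
  have "continuous_on {a..b} u'"
    using u' by (meson DERIV_isCont continuous_at_imp_continuous_on)
  then have "weak_deriv 1 {a<..<b} u u'" "weak_deriv 1 {a<..<b} u' u''"
    using assms by (blast intro: weak_deriv_1_classical DERIV_isCont)+
  with \<phi> test_function_deriv[OF \<phi>]
  show "(LINT x:{a<..<b}|lebesgue. u x * (deriv ^^ 2) \<phi> x) =
      (- 1) ^ 2 * (LINT x:{a<..<b}|lebesgue. u'' x * \<phi> x)"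
    by (auto simp: weak_deriv_def numeral_2_eq_2)
qed

section \<open>Continuous functions with vanishing second weak derivative\<close>

lemma smooth_shift_combination:
  fixes \<eta> :: "real \<Rightarrow> real"
  assumes "\<And>n x. (deriv ^^ n) \<eta> differentiable (at x)"
  shows "(deriv ^^ n) (\<lambda>x. r * \<eta> (x - a) + s * \<eta> (x - b) + t * \<eta> (x - c)) =
    (\<lambda>x. r * (deriv ^^ n) \<eta> (x - a) + s * (deriv ^^ n) \<eta> (x - b) + t * (deriv ^^ n) \<eta> (x - c))"
proof (induction n)
  case (Suc n)
  have D: "((\<lambda>x. (deriv ^^ n) \<eta> (x - y)) has_real_derivative (deriv ^^ Suc n) \<eta> (x - y)) (at x)" for x y
    using DERIV_chain2[OF smooth_has_real_derivative[OF assms, of n] DERIV_diff[OF DERIV_ident DERIV_const]]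
    by simp
  have "((\<lambda>x. r * (deriv ^^ n) \<eta> (x - a) + s * (deriv ^^ n) \<eta> (x - b) + t * (deriv ^^ n) \<eta> (x - c))
    has_real_derivative r * (deriv ^^ Suc n) \<eta> (x - a) + s * (deriv ^^ Suc n) \<eta> (x - b)
      + t * (deriv ^^ Suc n) \<eta> (x - c)) (at x)" for x
    by (intro DERIV_add DERIV_cmult D)
  then have "deriv (\<lambda>x. r * (deriv ^^ n) \<eta> (x - a) + s * (deriv ^^ n) \<eta> (x - b) + t * (deriv ^^ n) \<eta> (x - c))
      = (\<lambda>x. r * (deriv ^^ Suc n) \<eta> (x - a) + s * (deriv ^^ Suc n) \<eta> (x - b) + t * (deriv ^^ Suc n) \<eta> (x - c))"
    by (intro ext DERIV_imp_deriv)
  then show ?case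
    by (simp add: Suc.IH)
qed auto

lemma convex_combination_bounds:
  fixes a b t :: real
  assumes "0 \<le> t" "t \<le> 1" "a \<le> b"
  shows "a \<le> (1 - t) * a + t * b" "(1 - t) * a + t * b \<le> b"
proof -
  have "0 \<le> t * (b - a)" "0 \<le> (1 - t) * (b - a)"
    using assms by (intro mult_nonneg_nonneg; simp)+
  then show "a \<le> (1 - t) * a + t * b" "(1 - t) * a + t * b \<le> b"
    by (simp_all add: algebra_simps)
qed

text \<open>The double antiderivative of a combination of bumps whose zeroth and first moments vanish
  has compact support.\<close>

lemma test_function_bumps:
  fixes a b p q t \<epsilon> :: real
  assumes m: "m = (1 - t) * a + t * b" and "0 \<le> t" "t \<le> 1" "a \<le> b"
    and \<epsilon>: "0 < \<epsilon>" "p < a - \<epsilon>" "b + \<epsilon> < q"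
    and \<eta>: "\<And>n x. (deriv ^^ n) \<eta> differentiable (at x)"
    and H: "\<And>x. (H has_real_derivative H1 x) (at x)"
    and H1: "\<And>x. (H1 has_real_derivative \<eta> x) (at x)"
    and left: "\<And>x. x \<le> - \<epsilon> \<Longrightarrow> H x = 0" and right: "\<And>x. \<epsilon> \<le> x \<Longrightarrow> H x = \<kappa> * x + c"
  obtains \<phi> where "test_function {p<..<q} \<phi>"
    "(deriv ^^ 2) \<phi> = (\<lambda>x. (1 - t) * \<eta> (x - a) + (-1) * \<eta> (x - m) + t * \<eta> (x - b))"
proof -
  define \<phi> where "\<phi> x = (1 - t) * H (x - a) + (-1) * H (x - m) + t * H (x - b)" for x
  have dH: "deriv H = H1" "deriv H1 = \<eta>"
    using DERIV_imp_deriv[OF H] DERIV_imp_deriv[OF H1] by auto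
  have smooth_H: "(deriv ^^ n) H differentiable (at x)" for n x
  proof -
    \<comment> \<open>From order 2 on, the derivatives of \<open>H\<close> are derivatives of the
      smooth bump; orders 0 and 1 are covered by \<open>H\<close> and \<open>H1\<close>.\<close>
    consider "n = 0" | "n = 1" | k where "n = Suc (Suc k)"
      by (metis One_nat_def not0_implies_Suc)
    then show ?thesis
    proof cases
      case (3 k)
      then have "(deriv ^^ n) H = (deriv ^^ k) \<eta>"
        by (simp add: funpow_Suc_right dH del: funpow.simps)
      then show ?thesis
        using \<eta> by simp
    qed (use H H1 in \<open>auto simp: dH real_differentiable_def\<close>)
  qed
  have \<phi>_deriv: "(deriv ^^ n) \<phi> =
      (\<lambda>x. (1 - t) * (deriv ^^ n) H (x - a) + (-1) * (deriv ^^ n) H (x - m) + t * (deriv ^^ n) H (x - b))" for n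
    unfolding \<phi>_def using smooth_shift_combination[OF smooth_H] .
  have smooth: "(deriv ^^ n) \<phi> differentiable (at x)" for n x
  proof -
    have "(\<lambda>x. (deriv ^^ n) H (x - y)) differentiable (at x)" for y
      using differentiable_compose[of "(deriv ^^ n) H" "\<lambda>x. x - y" x UNIV] smooth_H by auto
    then show ?thesis
      unfolding \<phi>_deriv by (intro differentiable_add differentiable_mult differentiable_const)
  qed
  have "a \<le> m" "m \<le> b"
    using assms(2-4) unfolding m by (fact convex_combination_bounds)+
  have "\<phi> x = 0" if "x \<notin> {a - \<epsilon>..b + \<epsilon>}" for x
  proof (cases "x < a - \<epsilon>")
    case True
    then show ?thesis
      using \<open>a \<le> m\<close> \<open>a \<le> b\<close> by (simp add: \<phi>_def left)
  next
    case False
    \<comment> \<open>To the right of \<open>b + \<epsilon>\<close> all three terms are affine. The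
      constants cancel because the weights sum to 0, the slopes because of this too, and the shifts
      because \<open>m\<close> is the convex combination of \<open>a\<close> and
      \<open>b\<close>.\<close>
    then have "\<phi> x = (1 - t) * (\<kappa> * (x - a) + c) + (-1) * (\<kappa> * (x - m) + c) + t * (\<kappa> * (x - b) + c)"
      using that \<open>m \<le> b\<close> \<open>a \<le> b\<close> by (simp add: \<phi>_def right)
    then show ?thesis
      by (simp add: m algebra_simps)
  qed
  then have "{x. \<phi> x \<noteq> 0} \<subseteq> {a - \<epsilon>..b + \<epsilon>}"
    by blast
  then have cl: "closure {x. \<phi> x \<noteq> 0} \<subseteq> {a - \<epsilon>..b + \<epsilon>}"
    by (simp add: closure_minimal)
  then have "compact (closure {x. \<phi> x \<noteq> 0})"
    using compact_Int_closed[of "{a - \<epsilon>..b + \<epsilon>}" "closure {x. \<phi> x \<noteq> 0}"]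
    by (simp add: Int_absorb1)
  moreover have "closure {x. \<phi> x \<noteq> 0} \<subseteq> {p<..<q}"
    using cl \<epsilon> by force
  ultimately have "test_function {p<..<q} \<phi>"
    using smooth by (simp add: test_function_def)
  moreover have "(deriv ^^ 2) \<phi> = (\<lambda>x. (1 - t) * \<eta> (x - a) + (-1) * \<eta> (x - m) + t * \<eta> (x - b))"
    by (simp only: \<phi>_deriv) (simp add: numeral_2_eq_2 dH)
  ultimately show thesis
    using that by blast
qed

lemma integral_linear_combination:
  fixes f g h :: "real \<Rightarrow> real"
  assumes "f integrable_on S" "g integrable_on S" "h integrable_on S"
  shows "integral S (\<lambda>x. r * f x + s * g x + t * h x) = r * integral S f + s * integral S g + t * integral S h"
  using assms by (intro integral_unique has_integral_add has_integral_mult_right integrable_integral)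

text \<open>The integrand vanishes outside the \<open>\<epsilon>\<close>-neighbourhood of
  \<open>y\<close>, which lies in \<open>{p..q}\<close>; that neighbourhood is then translated to
  the origin.\<close>

lemma integral_shifted_bump:
  fixes w \<eta> :: "real \<Rightarrow> real"
  assumes w: "continuous_on {p..q} w" and \<eta>: "continuous_on UNIV \<eta>" "\<And>x. \<epsilon> \<le> \<bar>x\<bar> \<Longrightarrow> \<eta> x = 0"
    and y: "p \<le> y - \<epsilon>" "y + \<epsilon> \<le> q"
  shows "integral {p..q} (\<lambda>x. w x * \<eta> (x - y)) = integral {-\<epsilon>..\<epsilon>} (\<lambda>x. w (x + y) * \<eta> x)"
proof -
  have "continuous_on {y - \<epsilon>..y + \<epsilon>} (\<lambda>x. w x * \<eta> (x - y))"
    using y by (intro continuous_intros continuous_on_subset[OF w] continuous_on_compose2[OF \<eta>(1)]) auto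
  then have "((\<lambda>x. w x * \<eta> (x - y)) has_integral integral {y - \<epsilon>..y + \<epsilon>} (\<lambda>x. w x * \<eta> (x - y)))
      {y - \<epsilon>..y + \<epsilon>}"
    using integrable_continuous_real integrable_integral by blast
  then have "((\<lambda>x. w x * \<eta> (x - y)) has_integral integral {y - \<epsilon>..y + \<epsilon>} (\<lambda>x. w x * \<eta> (x - y))) {p..q}"
    by (rule has_integral_on_superset) (use y \<eta>(2) in auto)
  then show ?thesis
    using integral_shift_real_ivl[of "y - \<epsilon>" y "y + \<epsilon>" "\<lambda>x. w x * \<eta> (x - y)"]
    by (simp add: integral_unique)
qed

text \<open>If the convex combination failed, \<open>w\<close> could be tested against bumps concentrated at the three
  points, on which the defect keeps its sign.\<close>

lemma weak_deriv_2_zero_imp_convex_combination: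
  assumes w: "continuous_on {p..q} w" and weak: "weak_deriv 2 {p<..<q} w (\<lambda>_. 0)"
    and ab: "p < a" "a \<le> b" "b < q" and t: "0 \<le> t" "t \<le> 1"
  shows "w ((1 - t) * a + t * b) = (1 - t) * w a + t * w b"
proof (rule ccontr)
  define m where "m = (1 - t) * a + t * b"
  \<comment> \<open>\<open>W x\<close> is the defect of the claimed identity with all three points
    shifted by \<open>x\<close>; \<open>D\<close> is the defect itself.\<close>
  define W where "W x = (1 - t) * w (x + a) + (-1) * w (x + m) + t * w (x + b)" for x
  define D where "D = W 0"
  assume "w ((1 - t) * a + t * b) \<noteq> (1 - t) * w a + t * w b"
  then have D: "0 < D * D"
    by (auto simp: D_def W_def m_def zero_less_mult_iff linorder_neq_iff)
  have m: "a \<le> m" "m \<le> b"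
    unfolding m_def using t ab(2) by (fact convex_combination_bounds)+
  \<comment> \<open>Shifts by at most \<open>\<delta>\<close> keep the three points inside the
    interval.\<close>
  define \<delta> where "\<delta> = min (a - p) (q - b) / 2"
  have \<delta>: "0 < \<delta>" "p < a - \<delta>" "b + \<delta> < q"
    using ab by (auto simp: \<delta>_def min_def field_simps)
  have W: "continuous_on {-\<delta>..\<delta>} W"
    unfolding W_def using \<delta> m by (intro continuous_intros continuous_on_compose2[OF w]) auto
  \<comment> \<open>The factor \<open>D\<close> makes the value at 0 positive whatever the sign of
    the defect; by continuity it stays positive nearby.\<close>
  then have "continuous_on {-\<delta>..\<delta>} (\<lambda>x. D * W x)"
    by (intro continuous_intros)
  then obtain d where d: "0 < d" "\<And>x. x \<in> {-\<delta>..\<delta>} \<Longrightarrow> dist x 0 < d \<Longrightarrow> dist (D * W x) (D * W 0) < D * D"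
    unfolding continuous_on_iff using \<delta>(1) D by (metis atLeastAtMost_iff less_imp_le neg_le_0_iff_le)
  define \<epsilon> where "\<epsilon> = min \<delta> d / 2"
  have \<epsilon>: "0 < \<epsilon>" "\<epsilon> < \<delta>" "\<epsilon> < d"
    using \<delta>(1) d(1) by (auto simp: \<epsilon>_def min_def)
  have pos: "0 < D * W x" if "x \<in> {-\<epsilon>..\<epsilon>}" for x
  proof -
    have "x \<in> {-\<delta>..\<delta>}" "dist x 0 < d"
      using that \<epsilon> by auto
    from d(2)[OF this] have "\<bar>D * W x - D * D\<bar> < D * D"
      by (simp add: dist_real_def D_def)
    then show ?thesis
      by linarith
  qed
  obtain \<eta> H1 H \<kappa> c where
    \<eta>: "\<And>n x. (deriv ^^ n) \<eta> differentiable (at x)"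
    "\<And>x. 0 \<le> \<eta> x" "0 < \<eta> 0" "\<And>x. \<epsilon> \<le> \<bar>x\<bar> \<Longrightarrow> \<eta> x = 0"
    and H: "\<And>x. (H has_real_derivative H1 x) (at x)" "\<And>x. (H1 has_real_derivative \<eta> x) (at x)"
    "\<And>x. x \<le> - \<epsilon> \<Longrightarrow> H x = 0" "\<And>x. \<epsilon> \<le> x \<Longrightarrow> H x = \<kappa> * x + c"
    using obtain_bump[OF \<epsilon>(1)] by metis
  have c\<eta>: "continuous_on UNIV \<eta>"
    using \<eta>(1)[of 0] by (simp add: continuous_on_eq_continuous_at differentiable_imp_continuous_within)
  obtain \<phi> where \<phi>: "test_function {p<..<q} \<phi>"
    "(deriv ^^ 2) \<phi> = (\<lambda>x. (1 - t) * \<eta> (x - a) + (-1) * \<eta> (x - m) + t * \<eta> (x - b))"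
    by (rule test_function_bumps[OF m_def t ab(2) \<epsilon>(1) _ _ \<eta>(1) H]) (use \<epsilon> \<delta> in auto)
  have c1: "continuous_on {p..q} (\<lambda>x. w x * \<eta> (x - y))" for y
    using w by (intro continuous_intros continuous_on_compose2[OF c\<eta>]) auto
  have c2: "continuous_on {-\<epsilon>..\<epsilon>} (\<lambda>x. w (x + y) * \<eta> x)" if "a \<le> y" "y \<le> b" for y
    using that \<delta> \<epsilon>
    by (intro continuous_intros continuous_on_compose2[OF c\<eta>] continuous_on_compose2[OF w]) auto
  \<comment> \<open>Testing \<open>w\<close> against \<open>\<phi>\<close> gives 0. Moving each of
    the three bumps to the origin turns the same integral into that of
    \<open>W x * \<eta> x\<close>.\<close>
  have "0 = integral {p..q} (\<lambda>x. w x * (deriv ^^ 2) \<phi> x)"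
  proof -
    have "(LINT x:{p<..<q}|lebesgue. w x * (deriv ^^ 2) \<phi> x) = 0"
      using weak \<phi>(1) by (simp add: weak_deriv_def set_lebesgue_integral_def)
    then show ?thesis
      using w test_function_continuous_on[OF \<phi>(1)] by (subst (asm) LINT_Ioo_continuous) (auto intro!: continuous_intros)
  qed
  also have "\<dots> = integral {p..q} (\<lambda>x. (1 - t) * (w x * \<eta> (x - a)) + (-1) * (w x * \<eta> (x - m)) + t * (w x * \<eta> (x - b)))"
    unfolding \<phi>(2) by (simp add: algebra_simps)
  also have "\<dots> = (1 - t) * integral {p..q} (\<lambda>x. w x * \<eta> (x - a)) + (-1) * integral {p..q} (\<lambda>x. w x * \<eta> (x - m))
      + t * integral {p..q} (\<lambda>x. w x * \<eta> (x - b))"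
    by (intro integral_linear_combination integrable_continuous_real c1)
  also have "\<dots> = (1 - t) * integral {-\<epsilon>..\<epsilon>} (\<lambda>x. w (x + a) * \<eta> x) + (-1) * integral {-\<epsilon>..\<epsilon>} (\<lambda>x. w (x + m) * \<eta> x)
      + t * integral {-\<epsilon>..\<epsilon>} (\<lambda>x. w (x + b) * \<eta> x)"
    using integral_shifted_bump[OF w c\<eta> \<eta>(4)] m ab \<delta> \<epsilon> by simp
  also have "\<dots> = integral {-\<epsilon>..\<epsilon>} (\<lambda>x. (1 - t) * (w (x + a) * \<eta> x) + (-1) * (w (x + m) * \<eta> x) + t * (w (x + b) * \<eta> x))"
    using m ab by (intro integral_linear_combination[symmetric] integrable_continuous_real c2) auto
  also have "\<dots> = integral {-\<epsilon>..\<epsilon>} (\<lambda>x. W x * \<eta> x)"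
    by (simp add: W_def algebra_simps)
  finally have "integral {-\<epsilon>..\<epsilon>} (\<lambda>x. D * (W x * \<eta> x)) = 0"
    by simp
  moreover have "continuous_on {-\<epsilon>..\<epsilon>} (\<lambda>x. D * (W x * \<eta> x))"
    using \<epsilon> by (intro continuous_intros continuous_on_subset[OF W] continuous_on_subset[OF c\<eta>]) auto
  moreover have "0 \<le> D * (W x * \<eta> x)" if "x \<in> {-\<epsilon>..\<epsilon>}" for x
    using mult_nonneg_nonneg[OF less_imp_le[OF pos[OF that]] \<eta>(2)[of x]] by (simp add: mult.assoc)
  \<comment> \<open>A continuous nonnegative integrand with integral 0 vanishes everywhere, in
    particular at 0, where it is \<open>D * (D * \<eta> 0) > 0\<close>.\<close>
  ultimately have "\<forall>x\<in>{-\<epsilon>..\<epsilon>}. D * (W x * \<eta> x) = 0"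
    using integral_eq_0_iff[of "-\<epsilon>" \<epsilon> "\<lambda>x. D * (W x * \<eta> x)"] \<epsilon>(1) by simp
  from bspec[OF this, of 0] have "D * (D * \<eta> 0) = 0"
    using \<epsilon>(1) by (simp add: D_def)
  then show False
    using D \<eta>(3) by auto
qed

text \<open>The convex combination rule is available for the interior points
  \<open>p + \<epsilon>\<close> and \<open>q - \<epsilon>\<close>; continuity of \<open>w\<close>
  carries it to the endpoints as \<open>\<epsilon>\<close> tends to 0.\<close>

lemma weak_deriv_2_zero_imp_affine:
  assumes w: "continuous_on {p..q} w" and weak: "weak_deriv 2 {p<..<q} w (\<lambda>_. 0)"
    and "p < q" and t: "0 \<le> t" "t \<le> 1"
  shows "w ((1 - t) * p + t * q) = (1 - t) * w p + t * w q"
proof -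
  have lim: "((\<lambda>\<epsilon>. w (f \<epsilon>)) \<longlongrightarrow> w (f 0)) (at_right 0)"
    if "continuous_on UNIV f" "\<And>\<epsilon>. 0 \<le> \<epsilon> \<Longrightarrow> \<epsilon> \<le> (q - p) / 2 \<Longrightarrow> f \<epsilon> \<in> {p..q}" for f :: "real \<Rightarrow> real"
  proof -
    have "continuous_on {0..(q - p) / 2} (\<lambda>\<epsilon>. w (f \<epsilon>))"
      using that by (intro continuous_on_compose2[OF w] continuous_on_subset[OF that(1)]) auto
    then have "((\<lambda>\<epsilon>. w (f \<epsilon>)) \<longlongrightarrow> w (f 0)) (at 0 within {0..(q - p) / 2})"
      using assms(3) by (simp add: continuous_on_def)
    then show ?thesis
      using assms(3) by (simp add: at_within_Icc_at_right)
  qed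
  let ?l = "\<lambda>\<epsilon>. w ((1 - t) * (p + \<epsilon>) + t * (q - \<epsilon>))"
  let ?r = "\<lambda>\<epsilon>. (1 - t) * w (p + \<epsilon>) + t * w (q - \<epsilon>)"
  have in_pq: "(1 - t) * (p + \<epsilon>) + t * (q - \<epsilon>) \<in> {p..q}" if "0 \<le> \<epsilon>" "\<epsilon> \<le> (q - p) / 2" for \<epsilon>
    using convex_combination_bounds[OF t, of "p + \<epsilon>" "q - \<epsilon>"] that by auto
  have "(?l \<longlongrightarrow> w ((1 - t) * (p + 0) + t * (q - 0))) (at_right 0)"
    by (rule lim) (use in_pq in \<open>auto intro!: continuous_intros\<close>)
  moreover have "(?r \<longlongrightarrow> (1 - t) * w (p + 0) + t * w (q - 0)) (at_right 0)"
    using assms(3) by (intro tendsto_add tendsto_mult tendsto_const lim) (auto intro!: continuous_intros)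
  moreover have "\<forall>\<^sub>F \<epsilon> in at_right 0. ?r \<epsilon> = ?l \<epsilon>"
  proof -
    have "?r \<epsilon> = ?l \<epsilon>" if "\<epsilon> \<in> {0<..<(q - p) / 2}" for \<epsilon>
      using weak_deriv_2_zero_imp_convex_combination[OF w weak _ _ _ t, of "p + \<epsilon>" "q - \<epsilon>"] that
      by (simp add: field_simps)
    then show ?thesis
      using assms(3) by (intro eventually_at_rightI[of 0 "(q - p) / 2"]) auto
  qed
  ultimately show ?thesis
    using tendsto_unique[of "at_right 0" ?l] Lim_transform_eventually[of ?r _ "at_right 0" ?l] by fastforce
qed

section \<open>Edge profiles\<close>

text \<open>Continuity ensures that all integrals exist, so that they may be split.\<close>

lemma weak_deriv_diff_continuous:
  assumes "continuous_on {a..b} u" "continuous_on {a..b} v" "continuous_on {a..b} g" "continuous_on {a..b} h"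
    and "weak_deriv k {a<..<b} u g" "weak_deriv k {a<..<b} v h"
  shows "weak_deriv k {a<..<b} (\<lambda>x. u x - v x) (\<lambda>x. g x - h x)"
  unfolding weak_deriv_def
proof (intro allI impI)
  fix \<phi> assume \<phi>: "test_function {a<..<b} \<phi>"
  have int: "set_integrable lebesgue {a<..<b} (\<lambda>x. f x * (deriv ^^ n) \<phi> x)" if "continuous_on {a..b} f" for f n
    using that test_function_continuous_on[OF \<phi>]
    by (intro set_integrable_Ioo_continuous continuous_intros)
  have "(LINT x:{a<..<b}|lebesgue. (f x - f' x) * (deriv ^^ n) \<phi> x) =
      (LINT x:{a<..<b}|lebesgue. f x * (deriv ^^ n) \<phi> x) - (LINT x:{a<..<b}|lebesgue. f' x * (deriv ^^ n) \<phi> x)"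
    if "continuous_on {a..b} f" "continuous_on {a..b} f'" for f f' n
    using set_integral_diff(2)[OF int[OF that(1)] int[OF that(2)], of n n] by (simp add: left_diff_distrib)
  from this[of _ _ k] this[of _ _ 0]
  show "(LINT x:{a<..<b}|lebesgue. (u x - v x) * (deriv ^^ k) \<phi> x) =
      (- 1) ^ k * (LINT x:{a<..<b}|lebesgue. (g x - h x) * \<phi> x)"
    using assms \<phi> by (simp add: weak_deriv_def right_diff_distrib)
qed

text \<open>The solution of \<open>- u'' = 1\<close> on \<open>[0, L]\<close> with boundary values \<open>p\<close> and \<open>q\<close>.\<close>

definition edge_profile :: "real \<Rightarrow> real \<Rightarrow> real \<Rightarrow> real \<Rightarrow> real" where
  "edge_profile L p q x = p + ((q - p) / L + L / 2) * x - x\<^sup>2 / 2"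

lemma edge_profile_0 [simp]: "edge_profile L p q 0 = p"
  by (simp add: edge_profile_def)

lemma edge_profile_end [simp]: "L \<noteq> 0 \<Longrightarrow> edge_profile L p q L = q"
  by (simp add: edge_profile_def field_simps power2_eq_square)

lemma edge_profile_has_real_derivative:
  "(edge_profile L p q has_real_derivative (q - p) / L + L / 2 - x) (at x within S)"
  unfolding edge_profile_def [abs_def] by (auto intro!: derivative_eq_intros)

lemma continuous_on_edge_profile: "continuous_on S (edge_profile L p q)"
  unfolding edge_profile_def [abs_def] by (intro continuous_intros) auto

lemma weak_deriv_edge_profile:
  assumes "0 \<le> L"
  shows "weak_deriv 1 {0<..<L} (edge_profile L p q) (\<lambda>x. (q - p) / L + L / 2 - x)"
    and "weak_deriv 2 {0<..<L} (edge_profile L p q) (\<lambda>_. - 1)"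
proof -
  show "weak_deriv 1 {0<..<L} (edge_profile L p q) (\<lambda>x. (q - p) / L + L / 2 - x)"
    by (intro weak_deriv_1_classical assms edge_profile_has_real_derivative continuous_intros)
  have "((\<lambda>x. (q - p) / L + L / 2 - x) has_real_derivative - 1) (at x)" for x
    by (auto intro!: derivative_eq_intros)
  then show "weak_deriv 2 {0<..<L} (edge_profile L p q) (\<lambda>_. - 1)"
    by (intro weak_deriv_2_classical[OF assms edge_profile_has_real_derivative] continuous_intros)
qed

text \<open>Subtracting the profile with the same boundary values leaves a function with second weak
  derivative 0. It is affine and vanishes at both ends, hence is 0.\<close>

lemma weak_deriv_2_minus_one_iff:
  assumes w: "continuous_on {0..L} w" and L: "0 < L"
  shows "weak_deriv 2 {0<..<L} w (\<lambda>_. - 1) \<longleftrightarrow> (\<forall>x\<in>{0..L}. w x = edge_profile L (w 0) (w L) x)"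
proof
  let ?e = "edge_profile L (w 0) (w L)"
  assume "weak_deriv 2 {0<..<L} w (\<lambda>_. - 1)"
  then have "weak_deriv 2 {0<..<L} (\<lambda>x. w x - ?e x) (\<lambda>x. - 1 - - 1)"
    using weak_deriv_edge_profile[of L] L w continuous_on_edge_profile
    by (intro weak_deriv_diff_continuous) auto
  then have weak: "weak_deriv 2 {0<..<L} (\<lambda>x. w x - ?e x) (\<lambda>_. 0)"
    by simp
  have cont: "continuous_on {0..L} (\<lambda>x. w x - ?e x)"
    by (intro continuous_intros w continuous_on_edge_profile)
  show "\<forall>x\<in>{0..L}. w x = ?e x"
  proof
    fix x assume "x \<in> {0..L}"
    then show "w x = ?e x"
      using weak_deriv_2_zero_imp_affine[OF cont weak L, of "x / L"] L by simp
  qed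
next
  assume eq: "\<forall>x\<in>{0..L}. w x = edge_profile L (w 0) (w L) x"
  have "weak_deriv 2 {0<..<L} w (\<lambda>_. - 1) \<longleftrightarrow> weak_deriv 2 {0<..<L} (edge_profile L (w 0) (w L)) (\<lambda>_. - 1)"
    by (rule weak_deriv_cong[OF _ bspec[OF eq]]) auto
  then show "weak_deriv 2 {0<..<L} w (\<lambda>_. - 1)"
    using weak_deriv_edge_profile(2) L by simp
qed

lemma sobolev_H2_edge_profile:
  assumes "0 \<le> L" "\<And>x. x \<in> {0<..<L} \<Longrightarrow> w x = edge_profile L p q x"
  shows "sobolev_H2 {0<..<L} w"
proof -
  have "square_integrable_on {0<..<L} (edge_profile L p q)"
    "square_integrable_on {0<..<L} (\<lambda>x. (q - p) / L + L / 2 - x)"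
    "square_integrable_on {0<..<L} (\<lambda>x. - 1)"
    by (intro square_integrable_on_continuous continuous_on_edge_profile continuous_intros)+
  then have "sobolev_H2 {0<..<L} (edge_profile L p q)"
    unfolding sobolev_H2_def using weak_deriv_edge_profile[OF assms(1)] by blast
  then show ?thesis
    using assms(2) square_integrable_on_cong[of "{0<..<L}" w] weak_deriv_cong[of "{0<..<L}" w]
    by (auto simp: sobolev_H2_def)
qed

lemma LINT_edge_profile:
  assumes "0 < L"
  shows "(LINT x:{0..L}|lebesgue. edge_profile L p q x) = L ^ 3 / 12 + L / 2 * (p + q)"
proof -
  let ?F = "\<lambda>x. p * x + ((q - p) / L + L / 2) * x\<^sup>2 / 2 - x ^ 3 / 6"
  have "(edge_profile L p q has_integral ?F L - ?F 0) {0..L}"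
    using assms unfolding edge_profile_def [abs_def]
    by (intro fundamental_theorem_of_calculus)
      (auto intro!: derivative_eq_intros simp: has_real_derivative_iff_has_vector_derivative[symmetric] field_simps power2_eq_square)
  moreover have "?F L - ?F 0 = L ^ 3 / 12 + L / 2 * (p + q)"
    using assms by (simp add: field_simps power2_eq_square power3_eq_cube)
  ultimately show ?thesis
    using set_lebesgue_integral_eq_integral(2)[OF absolutely_integrable_continuous_real[OF continuous_on_edge_profile]]
    by (simp add: integral_unique)
qed

section \<open>The linear system for the vertex values\<close>

text \<open>A square matrix with trivial kernel has nonzero determinant and is therefore invertible.
  The bijection \<open>h\<close> enumerates \<open>V\<close>, because matrices are indexed by
  natural numbers; \<open>k\<close> is its inverse.\<close>

lemma finite_linear_system_solvable:
  fixes M :: "'a \<Rightarrow> 'a \<Rightarrow> 'b::field"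
  assumes V: "finite V"
    and ker: "\<And>x. \<forall>i\<in>V. (\<Sum>j\<in>V. M i j * x j) = 0 \<Longrightarrow> \<forall>j\<in>V. x j = 0"
  shows "\<exists>x. \<forall>i\<in>V. (\<Sum>j\<in>V. M i j * x j) = f i"
proof -
  define n where "n = card V"
  obtain h where h: "bij_betw h {0..<n} V"
    using ex_bij_betw_nat_finite[OF V] by (auto simp: n_def)
  define k where "k = inv_into {0..<n} h"
  have k: "k (h i) = i" if "i < n" for i
    using h that by (simp add: k_def bij_betw_inv_into_left)
  have hV: "h i \<in> V" if "i < n" for i
    using h that by (auto simp: bij_betw_def)
  have V_ex: "\<exists>i<n. v = h i" if "v \<in> V" for v
    using h that by (auto simp: bij_betw_def)
  define A where "A = mat n n (\<lambda>(i, j). M (h i) (h j))"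
  have A: "A \<in> carrier_mat n n"
    by (simp add: A_def)
  have mult: "vec_index (mult_mat_vec A v) i = (\<Sum>j\<in>V. M (h i) j * vec_index v (k j))"
    if "v \<in> carrier_vec n" "i < n" for v i
  proof -
    have "vec_index (mult_mat_vec A v) i = (\<Sum>j\<in>{0..<n}. M (h i) (h j) * vec_index v j)"
      using that by (simp add: A_def scalar_prod_def)
    also have "\<dots> = (\<Sum>j\<in>{0..<n}. M (h i) (h j) * vec_index v (k (h j)))"
      by (simp add: k)
    also have "\<dots> = (\<Sum>j\<in>V. M (h i) j * vec_index v (k j))"
      by (rule sum.reindex_bij_betw[OF h])
    finally show ?thesis .
  qed
  have "Determinant.det A \<noteq> 0"
  proof
    assume "Determinant.det A = 0"
    then obtain v where v: "v \<in> carrier_vec n" "v \<noteq> 0\<^sub>v n" "mult_mat_vec A v = 0\<^sub>v n"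
      using det_0_iff_vec_prod_zero[OF A] by blast
    have "\<forall>i\<in>V. (\<Sum>j\<in>V. M i j * vec_index v (k j)) = 0"
      using mult[OF v(1)] v(3) V_ex by fastforce
    then have "\<forall>j\<in>V. vec_index v (k j) = 0"
      by (rule ker)
    then have "vec_index v i = 0" if "i < n" for i
      using hV[OF that] k[OF that] by metis
    then have "v = 0\<^sub>v n"
      using v(1) by (intro eq_vecI) auto
    then show False
      using v(2) by simp
  qed
  from det_non_zero_imp_unit[OF A this] obtain B where B: "B \<in> carrier_mat n n" "A * B = 1\<^sub>m n"
    unfolding Units_def ring_mat_def by auto
  \<comment> \<open>With \<open>A * B = 1\<close> the vector \<open>B f\<close> is a
    solution.\<close>
  define v where "v = mult_mat_vec B (vec n (f \<circ> h))"
  have v: "v \<in> carrier_vec n"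
    using B(1) by (auto simp: v_def)
  have "mult_mat_vec A v = vec n (f \<circ> h)"
    unfolding v_def using assoc_mult_mat_vec[OF A B(1), of "vec n (f \<circ> h)"] B(2) by simp
  then have "\<forall>i\<in>V. (\<Sum>j\<in>V. M i j * vec_index v (k j)) = f i"
    using mult[OF v] V_ex by fastforce
  then show ?thesis
    by (intro exI[of _ "\<lambda>j. vec_index v (k j)"])
qed

section \<open>The weighted graph Laplacian on vertex values\<close>

definition edgewise_profile ::
    "('v, 'e) pre_digraph \<Rightarrow> ('e \<Rightarrow> real) \<Rightarrow> ('v \<Rightarrow> real) \<Rightarrow> 'e \<Rightarrow> real \<Rightarrow> real" where
  "edgewise_profile G l c e x =
    (if e \<in> arcs G \<and> x \<in> {0..l e} then edge_profile (l e) (c (tail G e)) (c (head G e)) x else 0)"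

text \<open>This is the matrix \<open>A\<close> of the system, applied to \<open>c\<close>. A loop
  occurs in both sums and contributes 0 to each.\<close>

definition discrete_laplacian ::
    "('v, 'e) pre_digraph \<Rightarrow> ('e \<Rightarrow> real) \<Rightarrow> ('v \<Rightarrow> real) \<Rightarrow> ('v \<Rightarrow> real) \<Rightarrow> 'v \<Rightarrow> real" where
  "discrete_laplacian G l \<alpha> c v =
     (\<Sum>e\<in>{e \<in> arcs G. tail G e = v}. (c v - c (head G e)) / l e) +
     (\<Sum>e\<in>{e \<in> arcs G. head G e = v}. (c v - c (tail G e)) / l e) + \<alpha> v * c v"

text \<open>This is the right-hand side \<open>b\<close>; a loop contributes its full
  length.\<close>

definition vertex_load :: "('v, 'e) pre_digraph \<Rightarrow> ('e \<Rightarrow> real) \<Rightarrow> 'v \<Rightarrow> real" where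
  "vertex_load G l v =
     (\<Sum>e\<in>{e \<in> arcs G. tail G e = v}. l e / 2) + (\<Sum>e\<in>{e \<in> arcs G. head G e = v}. l e / 2)"

definition vertex_solution ::
    "('v, 'e) pre_digraph \<Rightarrow> ('e \<Rightarrow> real) \<Rightarrow> ('v \<Rightarrow> real) \<Rightarrow> ('v \<Rightarrow> real) \<Rightarrow> bool" where
  "vertex_solution G l \<alpha> c \<longleftrightarrow> (\<forall>v\<in>verts G. discrete_laplacian G l \<alpha> c v = vertex_load G l v)"

definition nonsingular ::
    "('v, 'e) pre_digraph \<Rightarrow> ('e \<Rightarrow> real) \<Rightarrow> ('v \<Rightarrow> real) \<Rightarrow> bool" where
  "nonsingular G l \<alpha> \<longleftrightarrow>
     (\<forall>x. (\<forall>v\<in>verts G. discrete_laplacian G l \<alpha> x v = 0) \<longrightarrow> (\<forall>v\<in>verts G. x v = 0))"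

lemma discrete_laplacian_linear:
  "discrete_laplacian G l \<alpha> (\<lambda>v. r * x v + s * y v) v =
     r * discrete_laplacian G l \<alpha> x v + s * discrete_laplacian G l \<alpha> y v"
proof -
  have "(r * a + s * b - (r * a' + s * b')) / d = r * ((a - a') / d) + s * ((b - b') / d)"
    for a b a' b' d :: real
    by (simp add: diff_divide_distrib add_divide_distrib right_diff_distrib)
  then show ?thesis
    unfolding discrete_laplacian_def
    by (simp only: sum.distrib flip: sum_distrib_left) (simp add: algebra_simps)
qed

lemma discrete_laplacian_add:
  "discrete_laplacian G l \<alpha> (\<lambda>v. x v + y v) v = discrete_laplacian G l \<alpha> x v + discrete_laplacian G l \<alpha> y v"
  using discrete_laplacian_linear[of G l \<alpha> 1 x 1 y v] by simp

lemma discrete_laplacian_diff: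
  "discrete_laplacian G l \<alpha> (\<lambda>v. x v - y v) v = discrete_laplacian G l \<alpha> x v - discrete_laplacian G l \<alpha> y v"
  using discrete_laplacian_linear[of G l \<alpha> 1 x "-1" y v] by simp

lemma (in fin_digraph) sum_arcs_tail:
  fixes g :: "'a \<Rightarrow> 'b \<Rightarrow> real"
  shows "(\<Sum>v\<in>verts G. \<Sum>e\<in>{e \<in> arcs G. tail G e = v}. g v e) = (\<Sum>e\<in>arcs G. g (tail G e) e)"
proof -
  have "(\<Sum>v\<in>verts G. \<Sum>e\<in>{e \<in> arcs G. tail G e = v}. g v e) =
      (\<Sum>v\<in>verts G. \<Sum>e\<in>{e \<in> arcs G. tail G e = v}. g (tail G e) e)"
    by (intro sum.cong) auto
  also have "\<dots> = (\<Sum>e\<in>arcs G. g (tail G e) e)"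
    by (rule sum.group) auto
  finally show ?thesis .
qed

lemma (in fin_digraph) sum_arcs_head:
  fixes g :: "'a \<Rightarrow> 'b \<Rightarrow> real"
  shows "(\<Sum>v\<in>verts G. \<Sum>e\<in>{e \<in> arcs G. head G e = v}. g v e) = (\<Sum>e\<in>arcs G. g (head G e) e)"
proof -
  have "(\<Sum>v\<in>verts G. \<Sum>e\<in>{e \<in> arcs G. head G e = v}. g v e) =
      (\<Sum>v\<in>verts G. \<Sum>e\<in>{e \<in> arcs G. head G e = v}. g (head G e) e)"
    by (intro sum.cong) auto
  also have "\<dots> = (\<Sum>e\<in>arcs G. g (head G e) e)"
    by (rule sum.group) auto
  finally show ?thesis .
qed

lemma (in fin_digraph) sum_mult_vertex_load:
  "(\<Sum>v\<in>verts G. y v * vertex_load G l v) = (\<Sum>e\<in>arcs G. l e / 2 * (y (tail G e) + y (head G e)))"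
  by (simp add: vertex_load_def distrib_left sum_distrib_left sum.distrib sum_arcs_tail sum_arcs_head mult_ac)

text \<open>Summation by parts: the contributions of the two ends of each edge are collected. The
  resulting bilinear form is visibly symmetric, and for \<open>x = y\<close> and nonnegative
  \<open>\<alpha>\<close> it is a sum of nonnegative terms.\<close>

lemma (in fin_digraph) sum_mult_discrete_laplacian:
  "(\<Sum>v\<in>verts G. y v * discrete_laplacian G l \<alpha> x v) =
    (\<Sum>e\<in>arcs G. (y (tail G e) - y (head G e)) * (x (tail G e) - x (head G e)) / l e) +
    (\<Sum>v\<in>verts G. \<alpha> v * x v * y v)"
proof -
  have "(\<Sum>v\<in>verts G. y v * discrete_laplacian G l \<alpha> x v) =
    (\<Sum>e\<in>arcs G. y (tail G e) * ((x (tail G e) - x (head G e)) / l e)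
      + y (head G e) * ((x (head G e) - x (tail G e)) / l e)) + (\<Sum>v\<in>verts G. \<alpha> v * x v * y v)"
    by (simp add: discrete_laplacian_def distrib_left sum_distrib_left sum.distrib sum_arcs_tail sum_arcs_head mult_ac)
  also have "(\<Sum>e\<in>arcs G. y (tail G e) * ((x (tail G e) - x (head G e)) / l e)
      + y (head G e) * ((x (head G e) - x (tail G e)) / l e)) =
    (\<Sum>e\<in>arcs G. (y (tail G e) - y (head G e)) * (x (tail G e) - x (head G e)) / l e)"
    by (intro sum.cong) (simp_all add: diff_divide_distrib add_divide_distrib algebra_simps)
  finally show ?thesis .
qed

lemma (in fin_digraph) discrete_laplacian_symmetric:
  "(\<Sum>v\<in>verts G. y v * discrete_laplacian G l \<alpha> x v) = (\<Sum>v\<in>verts G. x v * discrete_laplacian G l \<alpha> y v)"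
  by (simp add: sum_mult_discrete_laplacian mult_ac)

lemma (in fin_digraph) nonsingular_imp_solvable:
  assumes "nonsingular G l \<alpha>"
  shows "\<exists>x. \<forall>v\<in>verts G. discrete_laplacian G l \<alpha> x v = f v"
proof -
  \<comment> \<open>The column \<open>w\<close> of \<open>M\<close> is the operator applied to the
    indicator function of \<open>w\<close>.\<close>
  define M :: "'a \<Rightarrow> 'a \<Rightarrow> real" where "M v w =
    (\<Sum>e\<in>{e \<in> arcs G. tail G e = v}. (of_bool (v = w) - of_bool (head G e = w)) / l e) +
    (\<Sum>e\<in>{e \<in> arcs G. head G e = v}. (of_bool (v = w) - of_bool (tail G e = w)) / l e) +
    \<alpha> v * of_bool (v = w)" for v w
  have delta: "(\<Sum>w\<in>verts G. of_bool (u = w) * x w) = x u" if "u \<in> verts G" for u and x :: "'a \<Rightarrow> real"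
  proof -
    have "(\<Sum>w\<in>verts G. of_bool (u = w) * x w) = (\<Sum>w\<in>verts G. if u = w then x w else 0)"
      by (intro sum.cong) auto
    then show ?thesis
      using that by simp
  qed
  have delta2: "(\<Sum>w\<in>verts G. (of_bool (u = w) - of_bool (u' = w)) / r * x w) = (x u - x u') / r"
    if "u \<in> verts G" "u' \<in> verts G" for u u' r and x :: "'a \<Rightarrow> real"
    using that by (simp add: left_diff_distrib sum_subtractf delta flip: sum_divide_distrib)
  have M: "(\<Sum>w\<in>verts G. M v w * x w) = discrete_laplacian G l \<alpha> x v" if "v \<in> verts G" for v x
  proof -
    have "(\<Sum>w\<in>verts G. M v w * x w) =
      (\<Sum>e\<in>{e \<in> arcs G. tail G e = v}. \<Sum>w\<in>verts G. (of_bool (v = w) - of_bool (head G e = w)) / l e * x w) +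
      (\<Sum>e\<in>{e \<in> arcs G. head G e = v}. \<Sum>w\<in>verts G. (of_bool (v = w) - of_bool (tail G e = w)) / l e * x w) +
      \<alpha> v * (\<Sum>w\<in>verts G. of_bool (v = w) * x w)"
      unfolding M_def distrib_right sum.distrib sum_distrib_right sum_distrib_left mult.assoc
      by (simp only: sum.swap[of _ "verts G"])
    also have "\<dots> = discrete_laplacian G l \<alpha> x v"
      unfolding discrete_laplacian_def delta[OF that]
      by (intro arg_cong2[where f = "(+)"] sum.cong refl delta2) (use that in auto)
    finally show ?thesis .
  qed
  have "\<exists>x. \<forall>v\<in>verts G. (\<Sum>w\<in>verts G. M v w * x w) = f v"
    by (rule finite_linear_system_solvable) (use assms in \<open>auto simp: M nonsingular_def\<close>)
  then show ?thesis
    by (simp add: M)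
qed

text \<open>The value of \<open>c\<close> at an isolated vertex leaves no trace in a family of
  functions on the edges. Without such vertices the family determines \<open>c\<close> on all
  vertices.\<close>

definition no_isolated_vertex :: "('v, 'e) pre_digraph \<Rightarrow> bool" where
  "no_isolated_vertex G \<longleftrightarrow> (\<forall>v\<in>verts G. \<exists>e\<in>arcs G. tail G e = v \<or> head G e = v)"

section \<open>Torsion functions as solutions of the linear system\<close>

context metric_graph
begin

lemma edgewise_profile_endpoints:
  assumes "e \<in> arcs G"
  shows "edgewise_profile G l c e 0 = c (tail G e)" "edgewise_profile G l c e (l e) = c (head G e)"
  using length_pos[OF assms] assms by (auto simp: edgewise_profile_def)

lemma edge_deriv_edgewise_profile:
  assumes e: "e \<in> arcs G" and x: "x \<in> {0..l e}"
  shows "edge_deriv l (edgewise_profile G l c) e x = (c (head G e) - c (tail G e)) / l e + l e / 2 - x"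
proof -
  have "(edgewise_profile G l c e has_vector_derivative (c (head G e) - c (tail G e)) / l e + l e / 2 - x)
      (at x within {0..l e})"
  proof (rule has_vector_derivative_transform[OF x])
    show "edgewise_profile G l c e y = edge_profile (l e) (c (tail G e)) (c (head G e)) y"
      if "y \<in> {0..l e}" for y
      using that e by (simp add: edgewise_profile_def)
  qed (use edge_profile_has_real_derivative in \<open>simp add: has_real_derivative_iff_has_vector_derivative\<close>)
  then show ?thesis
    unfolding edge_deriv_def using length_pos[OF e] x vector_derivative_within_closed_interval by blast
qed

text \<open>At either end of an edge, the derivative of the profile pointing into the vertex is the
  difference of the two vertex values divided by the length, minus half the length.\<close>

lemma normal_deriv_sum_edgewise_profile:
  "normal_deriv_sum G l (edgewise_profile G l c) v + \<alpha> v * c v =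
    discrete_laplacian G l \<alpha> c v - vertex_load G l v"
proof -
  have "(\<Sum>e\<in>{e \<in> arcs G. tail G e = v}. - edge_deriv l (edgewise_profile G l c) e 0) =
    (\<Sum>e\<in>{e \<in> arcs G. tail G e = v}. (c v - c (head G e)) / l e - l e / 2)"
    using length_pos
    by (intro sum.cong) (auto simp: edge_deriv_edgewise_profile less_imp_le diff_divide_distrib)
  moreover have "(\<Sum>e\<in>{e \<in> arcs G. head G e = v}. edge_deriv l (edgewise_profile G l c) e (l e)) =
    (\<Sum>e\<in>{e \<in> arcs G. head G e = v}. (c v - c (tail G e)) / l e - l e / 2)"
    using length_pos
    by (intro sum.cong) (auto simp: edge_deriv_edgewise_profile less_imp_le diff_divide_distrib)
  ultimately show ?thesis
    by (simp add: normal_deriv_sum_def discrete_laplacian_def vertex_load_def sum_subtractf)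
qed

text \<open>The differential equation forces the profile on each edge, and continuity supplies the
  vertex values \<open>c\<close>. The remaining vertex condition is the linear system by
  \<open>normal_deriv_sum_edgewise_profile\<close>.\<close>

lemma neg_laplacian_one_iff:
  "neg_laplacian G l \<alpha> u (\<lambda>_ _. 1) \<longleftrightarrow> (\<exists>c. vertex_solution G l \<alpha> c \<and> u = edgewise_profile G l c)"
proof
  assume u: "neg_laplacian G l \<alpha> u (\<lambda>_ _. 1)"
  then obtain c where c: "\<And>e. e \<in> arcs G \<Longrightarrow> u e 0 = c (tail G e) \<and> u e (l e) = c (head G e)"
      "\<And>v. v \<in> verts G \<Longrightarrow> normal_deriv_sum G l u v + \<alpha> v * c v = 0"
    by (auto simp: neg_laplacian_def laplacian_domain_def)
  have "u e x = edgewise_profile G l c e x" for e x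
  proof (cases "e \<in> arcs G \<and> x \<in> {0..l e}")
    case True
    then have "continuous_on {0..l e} (u e)" "weak_deriv 2 {0<..<l e} (u e) (\<lambda>_. - 1)"
      using u by (auto simp: neg_laplacian_def laplacian_domain_def)
    then have "\<forall>x\<in>{0..l e}. u e x = edge_profile (l e) (u e 0) (u e (l e)) x"
      using weak_deriv_2_minus_one_iff length_pos True by blast
    with True c(1)[of e] show ?thesis
      unfolding edgewise_profile_def by metis
  next
    case False
    then show ?thesis
      using u unfolding neg_laplacian_def laplacian_domain_def edgewise_profile_def by auto
  qed
  then have eq: "u = edgewise_profile G l c"
    by (intro ext)
  with c(2) have "vertex_solution G l \<alpha> c"
    by (simp add: vertex_solution_def normal_deriv_sum_edgewise_profile)
  with eq show "\<exists>c. vertex_solution G l \<alpha> c \<and> u = edgewise_profile G l c"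
    by blast
next
  assume "\<exists>c. vertex_solution G l \<alpha> c \<and> u = edgewise_profile G l c"
  then obtain c where c: "vertex_solution G l \<alpha> c" and u: "u = edgewise_profile G l c"
    by blast
  have eq: "u e x = edge_profile (l e) (c (tail G e)) (c (head G e)) x"
    if "e \<in> arcs G" "x \<in> {0..l e}" for e x
    using that by (simp add: u edgewise_profile_def)
  have cont: "continuous_on {0..l e} (u e)" if "e \<in> arcs G" for e
    by (rule continuous_on_eq[OF continuous_on_edge_profile eq[OF that, symmetric]])
  have weak: "weak_deriv 2 {0<..<l e} (u e) (\<lambda>_. - 1)" if "e \<in> arcs G" for e
  proof -
    have "u e 0 = c (tail G e)" "u e (l e) = c (head G e)"
      by (simp_all add: u edgewise_profile_endpoints that)
    then show ?thesis
      using weak_deriv_2_minus_one_iff[OF cont[OF that] length_pos[OF that]] eq[OF that] by presburger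
  qed
  have sob: "sobolev_H2 {0<..<l e} (u e)" if "e \<in> arcs G" for e
    by (rule sobolev_H2_edge_profile[OF _ eq[OF that]]) (use length_pos[OF that] in auto)
  have "u \<in> laplacian_domain G l \<alpha>"
  proof -
    have "\<forall>e\<in>arcs G. u e 0 = c (tail G e) \<and> u e (l e) = c (head G e)"
      by (simp add: u edgewise_profile_endpoints)
    moreover have "\<forall>v\<in>verts G. normal_deriv_sum G l u v + \<alpha> v * c v = 0"
      using c by (simp add: u normal_deriv_sum_edgewise_profile vertex_solution_def)
    moreover have "\<forall>e x. \<not> (e \<in> arcs G \<and> x \<in> {0..l e}) \<longrightarrow> u e x = 0"
      by (simp add: u edgewise_profile_def)
    ultimately show ?thesis
      unfolding laplacian_domain_def using cont sob by blast
  qed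
  moreover have "square_integrable_on {0<..<l e} (\<lambda>x. 1)" for e
    by (intro square_integrable_on_continuous continuous_intros)
  ultimately show "neg_laplacian G l \<alpha> u (\<lambda>_ _. 1)"
    using weak by (simp add: neg_laplacian_def)
qed

lemma edgewise_profile_eq_iff:
  assumes "no_isolated_vertex G"
  shows "edgewise_profile G l c = edgewise_profile G l c' \<longleftrightarrow> (\<forall>v\<in>verts G. c v = c' v)"
proof
  assume eq: "edgewise_profile G l c = edgewise_profile G l c'"
  show "\<forall>v\<in>verts G. c v = c' v"
  proof
    fix v assume "v \<in> verts G"
    then obtain e where "e \<in> arcs G" "tail G e = v \<or> head G e = v"
      using assms by (auto simp: no_isolated_vertex_def)
    with edgewise_profile_endpoints[of e] eq show "c v = c' v"
      by metis
  qed
next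
  assume "\<forall>v\<in>verts G. c v = c' v"
  then show "edgewise_profile G l c = edgewise_profile G l c'"
    by (intro ext) (auto simp: edgewise_profile_def)
qed

text \<open>Adding a kernel vector to a solution yields another solution, so uniqueness forces a
  trivial kernel. Conversely a trivial kernel gives uniqueness and, in finite dimension, also
  solvability.\<close>

lemma torsion_exists_iff_nonsingular:
  assumes "no_isolated_vertex G"
  shows "torsion_exists G l \<alpha> \<longleftrightarrow> nonsingular G l \<alpha>"
proof
  assume "torsion_exists G l \<alpha>"
  then obtain c where c: "vertex_solution G l \<alpha> c"
    and unique: "\<And>c'. vertex_solution G l \<alpha> c' \<Longrightarrow> edgewise_profile G l c' = edgewise_profile G l c"
    unfolding torsion_exists_def neg_laplacian_one_iff by blast
  show "nonsingular G l \<alpha>"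
    unfolding nonsingular_def
  proof (intro allI impI)
    fix x assume "\<forall>v\<in>verts G. discrete_laplacian G l \<alpha> x v = 0"
    with c have "vertex_solution G l \<alpha> (\<lambda>v. c v + x v)"
      by (simp add: vertex_solution_def discrete_laplacian_add)
    then have "edgewise_profile G l (\<lambda>v. c v + x v) = edgewise_profile G l c"
      by (rule unique)
    then have "\<forall>v\<in>verts G. c v + x v = c v"
      unfolding edgewise_profile_eq_iff[OF assms] .
    then show "\<forall>v\<in>verts G. x v = 0"
      by simp
  qed
next
  assume nonsing: "nonsingular G l \<alpha>"
  then obtain c where c: "vertex_solution G l \<alpha> c"
    using nonsingular_imp_solvable unfolding vertex_solution_def by blast
  have unique: "edgewise_profile G l c' = edgewise_profile G l c" if "vertex_solution G l \<alpha> c'" for c'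
  proof -
    have "\<forall>v\<in>verts G. discrete_laplacian G l \<alpha> (\<lambda>v. c' v - c v) v = 0"
      using that c by (simp add: vertex_solution_def discrete_laplacian_diff)
    then have "\<forall>v\<in>verts G. c' v - c v = 0"
      using nonsing unfolding nonsingular_def by blast
    then show ?thesis
      using edgewise_profile_eq_iff[OF assms] by simp
  qed
  show "torsion_exists G l \<alpha>"
    unfolding torsion_exists_def neg_laplacian_one_iff
  proof (rule ex1I)
    show "\<exists>c'. vertex_solution G l \<alpha> c' \<and> edgewise_profile G l c = edgewise_profile G l c'"
      using c by blast
  qed (metis unique)
qed

lemma torsion_eq_edgewise_profile:
  assumes "torsion_exists G l \<alpha>" "vertex_solution G l \<alpha> c"
  shows "torsion G l \<alpha> = edgewise_profile G l c"
  using assms unfolding torsion_def torsion_exists_def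
  by (intro the1_equality) (auto simp: neg_laplacian_one_iff)

text \<open>The profile is integrated over each edge, and the terms belonging to edge ends are
  regrouped by vertices.\<close>

lemma torsional_rigidity_eq:
  assumes "torsion_exists G l \<alpha>" "vertex_solution G l \<alpha> c"
  shows "torsional_rigidity G l \<alpha> = (\<Sum>e\<in>arcs G. l e ^ 3 / 12) + (\<Sum>v\<in>verts G. c v * vertex_load G l v)"
proof -
  have "(LINT x:{0..l e}|lebesgue. torsion G l \<alpha> e x) = l e ^ 3 / 12 + l e / 2 * (c (tail G e) + c (head G e))"
    if e: "e \<in> arcs G" for e
  proof -
    have "(LINT x:{0..l e}|lebesgue. torsion G l \<alpha> e x) =
        (LINT x:{0..l e}|lebesgue. edge_profile (l e) (c (tail G e)) (c (head G e)) x)"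
      by (intro set_lebesgue_integral_cong)
        (auto simp: torsion_eq_edgewise_profile[OF assms] edgewise_profile_def e)
    then show ?thesis
      by (simp add: LINT_edge_profile length_pos[OF e])
  qed
  then show ?thesis
    by (simp add: torsional_rigidity_def sum.distrib sum_mult_vertex_load)
qed

end

section \<open>Connectedness\<close>

text \<open>Joining to \<open>S\<close> the interiors of the edges with ends in \<open>S\<close>
  gives a subset that is both open and closed in the metric graph.\<close>

lemma connected_metric_graph_cut:
  assumes conn: "connected_metric_graph G l" and S: "S \<subseteq> verts G"
    and cut: "\<And>e. e \<in> arcs G \<Longrightarrow> tail G e \<in> S \<longleftrightarrow> head G e \<in> S"
  shows "S = {} \<or> S = verts G"
proof -
  interpret metric_graph G l
    using conn by (simp add: connected_metric_graph_def)
  define U where "U = Vertex ` S \<union> {Inner e x | e x. e \<in> arcs G \<and> 0 < x \<and> x < l e \<and> tail G e \<in> S}"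
  have U: "U \<subseteq> mg_points G l"
    using S by (auto simp: U_def mg_points_def)
  have glue_U: "glue G l e x \<in> U \<longleftrightarrow> tail G e \<in> S" and glue_points: "glue G l e x \<in> mg_points G l"
    if "e \<in> arcs G" "x \<in> {0..l e}" for e x
    using that cut[OF that(1)] by (auto simp: U_def glue_def mg_points_def)
  \<comment> \<open>Each edge lies entirely in \<open>U\<close> or entirely outside, since its two
    ends are on the same side of the cut.\<close>
  have "{x \<in> {0..l e}. glue G l e x \<in> U} = (if tail G e \<in> S then {0..l e} else {})"
    "{x \<in> {0..l e}. glue G l e x \<in> mg_points G l - U} = (if tail G e \<in> S then {} else {0..l e})"
    if "e \<in> arcs G" for e
    using glue_U[OF that] glue_points[OF that] by auto
  then have "openin (mg_topology G l) U" "openin (mg_topology G l) (topspace (mg_topology G l) - U)"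
    using U by (auto simp: openin_mg_topology mg_open_def topspace_mg_topology)
  then have "openin (mg_topology G l) U \<and> closedin (mg_topology G l) U"
    using U by (simp add: closedin_def topspace_mg_topology)
  moreover have "connected_space (mg_topology G l)"
    using conn by (simp add: connected_metric_graph_def path_connected_imp_connected_space)
  ultimately have "U = {} \<or> U = mg_points G l"
    unfolding connected_space_clopen_in topspace_mg_topology by blast
  then show ?thesis
    using S by (auto simp: U_def mg_points_def)
qed

text \<open>An isolated vertex would form a cut by itself and so be the only vertex, but then
  \<open>e0\<close> would have to be attached to it.\<close>

lemma connected_metric_graph_no_isolated_vertex:
  assumes conn: "connected_metric_graph G l" and "e0 \<in> arcs G"
  shows "no_isolated_vertex G"
proof (rule ccontr)
  interpret metric_graph G l
    using conn by (simp add: connected_metric_graph_def)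
  assume "\<not> ?thesis"
  then obtain v where v: "v \<in> verts G" "\<And>e. e \<in> arcs G \<Longrightarrow> tail G e \<noteq> v \<and> head G e \<noteq> v"
    unfolding no_isolated_vertex_def by blast
  then have "{v} = verts G"
    using connected_metric_graph_cut[OF conn, of "{v}"] by auto
  then show False
    using v(2)[OF assms(2)] tail_in_verts[OF assms(2)] by blast
qed

section \<open>Varying the length of an edge\<close>

lemma (in metric_graph) metric_graph_fun_upd:
  assumes "0 < s"
  shows "metric_graph G (l(e0 := s))"
  by unfold_locales (use assms length_pos in auto)

lemma sum_fun_upd_arg:
  fixes g :: "'a \<Rightarrow> 'b \<Rightarrow> real"
  assumes "finite A"
  shows "(\<Sum>e\<in>A. g e ((l(e0 := s)) e)) = (\<Sum>e\<in>A. g e (l e)) + (if e0 \<in> A then g e0 s - g e0 (l e0) else 0)"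
proof -
  have "(\<Sum>e\<in>A. g e ((l(e0 := s)) e)) = (\<Sum>e\<in>A. g e (l e) + (if e = e0 then g e0 s - g e0 (l e0) else 0))"
    by (intro sum.cong) auto
  then show ?thesis
    using assms by (simp add: sum.distrib)
qed

text \<open>The vector \<open>d\<close> spanning the rank-one perturbation: changing the length of
  \<open>e\<close> adds a multiple of \<open>d\<close> times its transpose to \<open>A\<close>. It
  is 0 for a loop.\<close>

definition vertex_diff :: "('v, 'e) pre_digraph \<Rightarrow> 'e \<Rightarrow> 'v \<Rightarrow> real" where
  "vertex_diff G e v = of_bool (tail G e = v) - of_bool (head G e = v)"

text \<open>The direction in which the load changes with the length of \<open>e\<close>; for a loop
  its value at the vertex is 2.\<close>

definition vertex_sum :: "('v, 'e) pre_digraph \<Rightarrow> 'e \<Rightarrow> 'v \<Rightarrow> real" where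
  "vertex_sum G e v = of_bool (tail G e = v) + of_bool (head G e = v)"

context metric_graph
begin

text \<open>Changing the length of a single edge is a perturbation of rank one.\<close>

lemma discrete_laplacian_fun_upd:
  assumes "e0 \<in> arcs G"
  shows "discrete_laplacian G (l(e0 := s)) \<alpha> c v = discrete_laplacian G l \<alpha> c v +
    (1 / s - 1 / l e0) * (c (tail G e0) - c (head G e0)) * vertex_diff G e0 v"
  using sum_fun_upd_arg[of "{e \<in> arcs G. tail G e = v}" "\<lambda>e r. (c v - c (head G e)) / r" l e0 s]
    sum_fun_upd_arg[of "{e \<in> arcs G. head G e = v}" "\<lambda>e r. (c v - c (tail G e)) / r" l e0 s] assms
  unfolding discrete_laplacian_def vertex_diff_def
  by (auto simp: algebra_simps diff_divide_distrib)

lemma vertex_load_fun_upd: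
  assumes "e0 \<in> arcs G"
  shows "vertex_load G (l(e0 := s)) v = vertex_load G l v + (s - l e0) / 2 * vertex_sum G e0 v"
  using sum_fun_upd_arg[of "{e \<in> arcs G. tail G e = v}" "\<lambda>e r. r / 2" l e0 s]
    sum_fun_upd_arg[of "{e \<in> arcs G. head G e = v}" "\<lambda>e r. r / 2" l e0 s] assms
  unfolding vertex_load_def vertex_sum_def
  by (auto simp: algebra_simps diff_divide_distrib)

lemma sum_mult_vertex_diff:
  assumes "e \<in> arcs G"
  shows "(\<Sum>v\<in>verts G. y v * vertex_diff G e v) = y (tail G e) - y (head G e)"
  using assms by (simp add: vertex_diff_def right_diff_distrib sum_subtractf sum.delta of_bool_def
      if_distrib[of "(*) _"] cong: if_cong)

lemma sum_mult_vertex_sum: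
  assumes "e \<in> arcs G"
  shows "(\<Sum>v\<in>verts G. y v * vertex_sum G e v) = y (tail G e) + y (head G e)"
  using assms by (simp add: vertex_sum_def distrib_left sum.distrib sum.delta of_bool_def
      if_distrib[of "(*) _"] cong: if_cong)

text \<open>The solution of the perturbed system is given by the Sherman--Morrison formula.\<close>

lemma perturbed_vertex_solution:
  assumes nonsing: "nonsingular G l \<alpha>" and e0: "e0 \<in> arcs G" and c: "vertex_solution G l \<alpha> c"
  obtains C where "C (l e0) = c" and "\<forall>v. isCont (\<lambda>s. C s v) (l e0)"
    and "\<forall>\<^sub>F s in nhds (l e0). 0 < s \<and> nonsingular G (l(e0 := s)) \<alpha> \<and> vertex_solution G (l(e0 := s)) \<alpha> (C s)"
proof -
  \<comment> \<open>\<open>y\<close> and \<open>z\<close> are the inverse of the unperturbed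
    operator applied to the direction of the rank-one change and to the direction of the load
    change.\<close>
  obtain y where y: "\<And>v. v \<in> verts G \<Longrightarrow> discrete_laplacian G l \<alpha> y v = vertex_diff G e0 v"
    using nonsingular_imp_solvable[OF nonsing] by metis
  obtain z where z: "\<And>v. v \<in> verts G \<Longrightarrow> discrete_laplacian G l \<alpha> z v = vertex_sum G e0 v"
    using nonsingular_imp_solvable[OF nonsing] by metis
  define jump where "jump x = x (tail G e0) - x (head G e0)" for x :: "_ \<Rightarrow> real"
  define \<kappa> where "\<kappa> s = 1 / s - 1 / l e0" for s
  \<comment> \<open>This is the Sherman-Morrison denominator; it equals 1 at the original
    length.\<close>
  define den where "den s = 1 + \<kappa> s * jump y" for s
  define r where "r s = (s - l e0) / 2" for s
  \<comment> \<open>Chosen so that \<open>\<tau> s = \<kappa> s * jump (C s)\<close> when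
    \<open>den s\<close> is nonzero; the \<open>y\<close> term of \<open>C s\<close> then cancels
    the rank-one change.\<close>
  define \<tau> where "\<tau> s = \<kappa> s * (jump c + r s * jump z) / den s" for s
  define C where "C s v = c v + (r s * z v + (- \<tau> s) * y v)" for s v
  have pos: "0 < l e0"
    using length_pos[OF e0] .
  have at_l: "\<kappa> (l e0) = 0" "den (l e0) = 1" "r (l e0) = 0" "\<tau> (l e0) = 0"
    by (simp_all add: \<kappa>_def den_def r_def \<tau>_def)
  have cont_\<kappa>: "isCont \<kappa> (l e0)" and cont_r: "isCont r (l e0)"
    using pos unfolding \<kappa>_def [abs_def] r_def [abs_def] by (auto intro!: continuous_intros)
  then have cont_den: "isCont den (l e0)"
    unfolding den_def [abs_def] by (auto intro!: continuous_intros)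
  then have cont_\<tau>: "isCont \<tau> (l e0)"
    using cont_\<kappa> cont_r at_l(2) unfolding \<tau>_def [abs_def] by (auto intro!: continuous_intros)
  have upd: "discrete_laplacian G (l(e0 := s)) \<alpha> x v = discrete_laplacian G l \<alpha> x v + \<kappa> s * jump x * vertex_diff G e0 v"
    for s x v
    using discrete_laplacian_fun_upd[OF e0] by (simp add: \<kappa>_def jump_def)
  have nonsing_s: "nonsingular G (l(e0 := s)) \<alpha>" if "den s \<noteq> 0" for s
    unfolding nonsingular_def
  proof (intro allI impI)
    fix x assume x: "\<forall>v\<in>verts G. discrete_laplacian G (l(e0 := s)) \<alpha> x v = 0"
    \<comment> \<open>A kernel vector \<open>x\<close> of the perturbed operator must be
      \<open>- \<kappa> s * jump x\<close> times \<open>y\<close>. Taking jumps gives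
      \<open>jump x * den s = 0\<close>, so \<open>x\<close> vanishes.\<close>
    have "\<forall>v\<in>verts G. discrete_laplacian G l \<alpha> (\<lambda>v. 1 * x v + (\<kappa> s * jump x) * y v) v = 0"
      using x unfolding discrete_laplacian_linear by (simp add: upd y)
    then have "\<forall>v\<in>verts G. 1 * x v + (\<kappa> s * jump x) * y v = 0"
      using nonsing unfolding nonsingular_def by blast
    then have x_eq: "x v = - (\<kappa> s * jump x) * y v" if "v \<in> verts G" for v
      using that by fastforce
    have "jump x = - (\<kappa> s * jump x) * y (tail G e0) - - (\<kappa> s * jump x) * y (head G e0)"
      by (subst (1) jump_def) (simp only: x_eq[OF tail_in_verts[OF e0]] x_eq[OF head_in_verts[OF e0]])
    then have "jump x * den s = 0"
      by (simp add: den_def jump_def[of y] algebra_simps)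
    then show "\<forall>v\<in>verts G. x v = 0"
      using that x_eq by simp
  qed
  have sol_s: "vertex_solution G (l(e0 := s)) \<alpha> (C s)" if "den s \<noteq> 0" for s
    unfolding vertex_solution_def
  proof
    fix v assume v: "v \<in> verts G"
    have "\<tau> s * den s = \<kappa> s * (jump c + r s * jump z)"
      using that by (simp add: \<tau>_def)
    moreover have "\<kappa> s * jump (C s) = \<kappa> s * (jump c + r s * jump z) - \<tau> s * (\<kappa> s * jump y)"
      by (simp add: jump_def C_def algebra_simps)
    ultimately have "\<kappa> s * jump (C s) = \<tau> s * den s - \<tau> s * (\<kappa> s * jump y)"
      by simp
    then have "\<kappa> s * jump (C s) = \<tau> s"
      by (simp add: den_def algebra_simps)
    moreover have "discrete_laplacian G l \<alpha> (C s) v =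
        discrete_laplacian G l \<alpha> c v + (r s * discrete_laplacian G l \<alpha> z v + (- \<tau> s) * discrete_laplacian G l \<alpha> y v)"
      unfolding C_def [abs_def] by (simp only: discrete_laplacian_add[of _ _ _ c] discrete_laplacian_linear)
    moreover have "discrete_laplacian G l \<alpha> c v = vertex_load G l v"
      using c v by (simp add: vertex_solution_def)
    ultimately show "discrete_laplacian G (l(e0 := s)) \<alpha> (C s) v = vertex_load G (l(e0 := s)) v"
      using v by (simp add: upd vertex_load_fun_upd[OF e0] r_def y z)
  qed
  show thesis
  proof (rule that[of C])
    show "C (l e0) = c"
      by (simp add: C_def at_l fun_eq_iff)
    show "\<forall>v. isCont (\<lambda>s. C s v) (l e0)"
      unfolding C_def using cont_r cont_\<tau> by (intro allI continuous_intros)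
    have "\<forall>\<^sub>F s in nhds (l e0). 0 < s"
      using pos by (intro order_tendstoD(1)[OF filterlim_ident]) 
    moreover have "\<forall>\<^sub>F s in nhds (l e0). den s \<noteq> 0"
    proof -
      have "(den \<longlongrightarrow> den (l e0)) (nhds (l e0))"
        using cont_den by (simp add: continuous_at tendsto_nhds_iff)
      then show ?thesis
        by (rule tendsto_imp_eventually_ne) (simp add: at_l)
    qed
    ultimately show "\<forall>\<^sub>F s in nhds (l e0). 0 < s \<and> nonsingular G (l(e0 := s)) \<alpha> \<and> vertex_solution G (l(e0 := s)) \<alpha> (C s)"
      by eventually_elim (use nonsing_s sol_s in auto)
  qed
qed

text \<open>Both sums are compared with the pairing of the two solutions, using the symmetry of the
  unperturbed operator.\<close>

lemma sum_mult_vertex_load_diff: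
  assumes e0: "e0 \<in> arcs G" and c: "vertex_solution G l \<alpha> c" and c': "vertex_solution G (l(e0 := s)) \<alpha> c'"
  shows "(\<Sum>v\<in>verts G. c' v * vertex_load G (l(e0 := s)) v) - (\<Sum>v\<in>verts G. c v * vertex_load G l v) =
    (s - l e0) / 2 * (c' (tail G e0) + c' (head G e0) + c (tail G e0) + c (head G e0))
    - (1 / s - 1 / l e0) * (c' (tail G e0) - c' (head G e0)) * (c (tail G e0) - c (head G e0))"
proof -
  have load: "(\<Sum>v\<in>verts G. x v * vertex_load G (l(e0 := s)) v) =
      (\<Sum>v\<in>verts G. x v * vertex_load G l v) + (s - l e0) / 2 * (x (tail G e0) + x (head G e0))" for x
  proof -
    have "(\<Sum>v\<in>verts G. x v * vertex_load G (l(e0 := s)) v) =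
      (\<Sum>v\<in>verts G. x v * vertex_load G l v) + (s - l e0) / 2 * (\<Sum>v\<in>verts G. x v * vertex_sum G e0 v)"
      by (simp add: vertex_load_fun_upd[OF e0] distrib_left sum.distrib sum_distrib_left mult_ac)
    then show ?thesis
      by (simp only: sum_mult_vertex_sum[OF e0])
  qed
  \<comment> \<open>The perturbed load is replaced by the perturbed operator applied to
    \<open>c'\<close>; the unperturbed part of that operator is then moved over to \<open>c\<close>
    by symmetry.\<close>
  have "(\<Sum>v\<in>verts G. c v * vertex_load G (l(e0 := s)) v) =
      (\<Sum>v\<in>verts G. c v * discrete_laplacian G (l(e0 := s)) \<alpha> c' v)"
    using c' by (simp add: vertex_solution_def)
  also have "\<dots> = (\<Sum>v\<in>verts G. c v * discrete_laplacian G l \<alpha> c' v) +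
      (1 / s - 1 / l e0) * (c' (tail G e0) - c' (head G e0)) * (\<Sum>v\<in>verts G. c v * vertex_diff G e0 v)"
    by (simp add: discrete_laplacian_fun_upd[OF e0] distrib_left sum.distrib sum_distrib_left mult_ac)
  also have "(\<Sum>v\<in>verts G. c v * discrete_laplacian G l \<alpha> c' v) = (\<Sum>v\<in>verts G. c' v * vertex_load G l v)"
    using c by (simp add: discrete_laplacian_symmetric[of c] vertex_solution_def)
  finally have "(\<Sum>v\<in>verts G. c v * vertex_load G (l(e0 := s)) v) = (\<Sum>v\<in>verts G. c' v * vertex_load G l v) +
      (1 / s - 1 / l e0) * (c' (tail G e0) - c' (head G e0)) * (c (tail G e0) - c (head G e0))"
    by (simp only: sum_mult_vertex_diff[OF e0])
  moreover have "(s - l e0) / 2 * (c' (tail G e0) + c' (head G e0) + c (tail G e0) + c (head G e0)) =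
      (s - l e0) / 2 * (c' (tail G e0) + c' (head G e0)) + (s - l e0) / 2 * (c (tail G e0) + c (head G e0))"
    by (simp only: distrib_left add.assoc)
  ultimately show ?thesis
    using load[of c] load[of c'] by linarith
qed

end

text \<open>The right-hand side of the derivative formula, as a function of the evaluation
  point.\<close>

definition hadamard_density ::
    "('v, 'e) pre_digraph \<Rightarrow> ('e \<Rightarrow> real) \<Rightarrow> ('v \<Rightarrow> real) \<Rightarrow> 'e \<Rightarrow> real \<Rightarrow> real" where
  "hadamard_density G l \<alpha> e x = 2 * torsion G l \<alpha> e x + (edge_deriv l (torsion G l \<alpha>) e x)\<^sup>2"

context metric_graph
begin

text \<open>With \<open>u'' = - 1\<close> the derivative of \<open>2 * u + u'\<^sup>2\<close> is
  \<open>2 * u' * (1 + u'') = 0\<close>, so the density is constant along the edge. Expanding the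
  profile gives the constant in terms of the vertex values.\<close>

lemma hadamard_density_eq:
  assumes "torsion_exists G l \<alpha>" "vertex_solution G l \<alpha> c" "e \<in> arcs G" "x \<in> {0..l e}"
  shows "hadamard_density G l \<alpha> e x = (l e)\<^sup>2 / 4 + (c (tail G e) + c (head G e)) +
    ((c (tail G e) - c (head G e)) / l e)\<^sup>2"
  using assms length_pos[OF assms(3)]
  by (simp add: hadamard_density_def torsion_eq_edgewise_profile edge_deriv_edgewise_profile)
    (simp add: edgewise_profile_def edge_profile_def field_simps power2_eq_square)

text \<open>Everything is local at the given length; other lengths are reached by taking the graph
  with the changed length as the starting graph. The difference quotient is an explicit
  \<open>g\<close> that is continuous because \<open>C\<close> is.\<close>

lemma torsion_perturbation:
  assumes iso: "no_isolated_vertex G" and ex: "torsion_exists G l \<alpha>" and e0: "e0 \<in> arcs G"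
  shows "\<forall>\<^sub>F s in nhds (l e0). 0 < s \<and> torsion_exists G (l(e0 := s)) \<alpha>"
    and "isCont (\<lambda>s. hadamard_density G (l(e0 := s)) \<alpha> e0 0) (l e0)"
    and "((\<lambda>s. torsional_rigidity G (l(e0 := s)) \<alpha>) has_real_derivative
      hadamard_density G l \<alpha> e0 0) (at (l e0))"
proof -
  let ?t = "tail G e0" and ?h = "head G e0" and ?l = "l e0"
  have nonsing: "nonsingular G l \<alpha>"
    using ex torsion_exists_iff_nonsingular[OF iso] by simp
  obtain c where c: "vertex_solution G l \<alpha> c"
    using ex unfolding torsion_exists_def neg_laplacian_one_iff by blast
  obtain C where C: "C ?l = c" "\<forall>v. isCont (\<lambda>s. C s v) ?l"
    and ev: "\<forall>\<^sub>F s in nhds ?l. 0 < s \<and> nonsingular G (l(e0 := s)) \<alpha> \<and> vertex_solution G (l(e0 := s)) \<alpha> (C s)"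
    using perturbed_vertex_solution[OF nonsing e0 c] by blast
  have pos: "0 < ?l"
    using length_pos[OF e0] .
  have ex_s: "\<forall>\<^sub>F s in nhds ?l. 0 < s \<and> torsion_exists G (l(e0 := s)) \<alpha> \<and> vertex_solution G (l(e0 := s)) \<alpha> (C s)"
    using ev
  proof eventually_elim
    case (elim s)
    then interpret s: metric_graph G "l(e0 := s)"
      by (intro metric_graph_fun_upd) simp
    show ?case
      using elim s.torsion_exists_iff_nonsingular[OF iso] by simp
  qed
  then show "\<forall>\<^sub>F s in nhds ?l. 0 < s \<and> torsion_exists G (l(e0 := s)) \<alpha>"
    by eventually_elim simp
  have "\<forall>\<^sub>F s in nhds ?l. hadamard_density G (l(e0 := s)) \<alpha> e0 0 =
      s\<^sup>2 / 4 + (C s ?t + C s ?h) + ((C s ?t - C s ?h) / s)\<^sup>2"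
    using ex_s
  proof eventually_elim
    case (elim s)
    then interpret s: metric_graph G "l(e0 := s)"
      by (intro metric_graph_fun_upd) simp
    show ?case
      using elim s.hadamard_density_eq[of \<alpha> "C s" e0 0] e0 by simp
  qed
  then show "isCont (\<lambda>s. hadamard_density G (l(e0 := s)) \<alpha> e0 0) ?l"
    using pos spec[OF C(2)] by (subst isCont_cong) (auto intro!: continuous_intros)
  \<comment> \<open>Both \<open>s ^ 3 - ?l ^ 3\<close> and \<open>1 / s - 1 / ?l\<close> contain the
    factor \<open>s - ?l\<close>, which is divided out here.\<close>
  define g where "g s = (s\<^sup>2 + s * ?l + ?l\<^sup>2) / 12 + (C s ?t + C s ?h + c ?t + c ?h) / 2
    + (C s ?t - C s ?h) * (c ?t - c ?h) / (s * ?l)" for s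
  have quotient: "\<forall>\<^sub>F s in nhds ?l. torsional_rigidity G (l(e0 := s)) \<alpha> - torsional_rigidity G l \<alpha> = (s - ?l) * g s"
    using ex_s
  proof eventually_elim
    case (elim s)
    then interpret s: metric_graph G "l(e0 := s)"
      by (intro metric_graph_fun_upd) simp
    have "torsional_rigidity G (l(e0 := s)) \<alpha> - torsional_rigidity G l \<alpha> = (s ^ 3 / 12 - ?l ^ 3 / 12) +
        ((\<Sum>v\<in>verts G. C s v * vertex_load G (l(e0 := s)) v) - (\<Sum>v\<in>verts G. c v * vertex_load G l v))"
      using elim e0 sum_fun_upd_arg[of "arcs G" "\<lambda>e r. r ^ 3 / 12" l e0 s]
      by (simp add: torsional_rigidity_eq[OF ex c] s.torsional_rigidity_eq[of \<alpha> "C s"])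
    also have "\<dots> = (s ^ 3 / 12 - ?l ^ 3 / 12) + ((s - ?l) / 2 * (C s ?t + C s ?h + c ?t + c ?h)
        - (1 / s - 1 / ?l) * (C s ?t - C s ?h) * (c ?t - c ?h))"
      using sum_mult_vertex_load_diff[OF e0 c] elim by simp
    also have "\<dots> = (s - ?l) * g s"
    proof -
      have "1 / s - 1 / ?l = - (s - ?l) / (s * ?l)"
        using elim pos by (simp add: field_simps)
      then have "(1 / s - 1 / ?l) * (C s ?t - C s ?h) * (c ?t - c ?h) =
          - (s - ?l) * ((C s ?t - C s ?h) * (c ?t - c ?h) / (s * ?l))"
        by simp
      moreover have "s ^ 3 / 12 - ?l ^ 3 / 12 = (s - ?l) * ((s\<^sup>2 + s * ?l + ?l\<^sup>2) / 12)"
        by (simp add: field_simps power2_eq_square power3_eq_cube)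
      moreover have "a * (A + B / 2 + D) = a * A + (a / 2 * B + a * D)" for a A B D :: real
        by (simp add: field_simps)
      ultimately show ?thesis
        unfolding g_def by (simp only: minus_mult_left [symmetric] diff_minus_eq_add)
    qed
    finally show ?case .
  qed
  have "isCont g ?l"
    unfolding g_def using pos spec[OF C(2)] by (auto intro!: continuous_intros)
  then have "(g \<longlongrightarrow> g ?l) (at ?l)"
    by (simp add: continuous_at)
  moreover have "\<forall>\<^sub>F s in at ?l. g s = (torsional_rigidity G (l(e0 := s)) \<alpha> - torsional_rigidity G l \<alpha>) / (s - ?l)"
    using quotient unfolding eventually_at_filter by eventually_elim auto
  ultimately have "((\<lambda>s. (torsional_rigidity G (l(e0 := s)) \<alpha> - torsional_rigidity G l \<alpha>) / (s - ?l)) \<longlongrightarrow> g ?l) (at ?l)"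
    by (rule Lim_transform_eventually)
  \<comment> \<open>At \<open>s = ?l\<close> the three terms become a quarter of the squared length,
    the sum of the end values, and the square of their difference divided by the length.\<close>
  moreover have "g ?l = hadamard_density G l \<alpha> e0 0"
    using pos hadamard_density_eq[OF ex c e0, of 0] by (simp add: g_def C(1) field_simps power2_eq_square)
  ultimately show "((\<lambda>s. torsional_rigidity G (l(e0 := s)) \<alpha>) has_real_derivative
      hadamard_density G l \<alpha> e0 0) (at ?l)"
    by (simp add: has_field_derivative_iff)
qed

end

text \<open>\<open>U\<close> consists of all admissible lengths. Applying the local result at each
  \<open>s\<close> in \<open>U\<close>, with \<open>l(e0 := s)\<close> as the original lengths,
  gives openness, differentiability and continuity of the derivative.\<close>

lemma rigidity_C1_on_torsion_exists:
  fixes l :: "'e \<Rightarrow> real"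
  assumes graph: "metric_graph G l" and iso: "no_isolated_vertex G" and e0: "e0 \<in> arcs G"
    and U_def: "U = {s. 0 < s \<and> torsion_exists G (l(e0 := s)) \<alpha>}"
  shows "open U" "rigidity_C1_on G l \<alpha> e0 U"
proof -
  let ?D = "\<lambda>s. hadamard_density G (l(e0 := s)) \<alpha> e0 0"
  have at_s: "(\<forall>\<^sub>F r in nhds s. r \<in> U) \<and> isCont ?D s \<and>
      ((\<lambda>r. torsional_rigidity G (l(e0 := r)) \<alpha>) has_real_derivative ?D s) (at s)" if "s \<in> U" for s
  proof -
    interpret s: metric_graph G "l(e0 := s)"
      using that metric_graph.metric_graph_fun_upd[OF graph] by (simp add: U_def)
    show ?thesis
      using s.torsion_perturbation[OF iso _ e0, of \<alpha>] that by (simp add: U_def)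
  qed
  show "open U"
    unfolding open_subopen[of U]
  proof
    fix s assume "s \<in> U"
    then have "\<forall>\<^sub>F r in nhds s. r \<in> U"
      using at_s by blast
    then show "\<exists>T. open T \<and> s \<in> T \<and> T \<subseteq> U"
      unfolding eventually_nhds by blast
  qed
  have "continuous_on U ?D"
    using at_s by (intro continuous_at_imp_continuous_on) blast
  moreover have "\<forall>s\<in>U. ((\<lambda>r. torsional_rigidity G (l(e0 := r)) \<alpha>) has_vector_derivative ?D s) (at s)"
    using at_s by (simp add: has_real_derivative_iff_has_vector_derivative)
  ultimately show "rigidity_C1_on G l \<alpha> e0 U"
    unfolding rigidity_C1_on_def C1_differentiable_on_def by (auto simp: U_def)
qed

text \<open>Pairing the equation with \<open>x\<close> gives a vanishing sum of nonnegative terms.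
  So \<open>x\<close> agrees at the two ends of each edge and is 0 at \<open>w\<close>, and its zero
  set is a nonempty cut. Connectedness enters only as the combinatorial property \<open>cut\<close>,
  which is the same for all edge lengths.\<close>

lemma nonsingular_if_nonneg:
  assumes graph: "metric_graph G l"
    and cut: "\<And>S. S \<subseteq> verts G \<Longrightarrow> (\<And>e. e \<in> arcs G \<Longrightarrow> tail G e \<in> S \<longleftrightarrow> head G e \<in> S) \<Longrightarrow> S = {} \<or> S = verts G"
    and nonneg: "\<And>v. v \<in> verts G \<Longrightarrow> 0 \<le> \<alpha> v" and w: "w \<in> verts G" "\<alpha> w \<noteq> 0"
  shows "nonsingular G l \<alpha>"
  unfolding nonsingular_def
proof (intro allI impI)
  interpret metric_graph G l
    by (rule graph)
  fix x assume x: "\<forall>v\<in>verts G. discrete_laplacian G l \<alpha> x v = 0"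
  let ?q = "\<lambda>e. (x (tail G e) - x (head G e)) * (x (tail G e) - x (head G e)) / l e"
  have "(\<Sum>e\<in>arcs G. ?q e) + (\<Sum>v\<in>verts G. \<alpha> v * x v * x v) = 0"
    using x sum_mult_discrete_laplacian[of x l \<alpha> x] by simp
  moreover have q: "\<And>e. e \<in> arcs G \<Longrightarrow> 0 \<le> ?q e" and p: "\<And>v. v \<in> verts G \<Longrightarrow> 0 \<le> \<alpha> v * x v * x v"
    using length_pos nonneg by (auto simp: mult.assoc less_imp_le)
  moreover have "0 \<le> (\<Sum>e\<in>arcs G. ?q e)" "0 \<le> (\<Sum>v\<in>verts G. \<alpha> v * x v * x v)"
    using q p by (auto intro: sum_nonneg)
  ultimately have "(\<Sum>e\<in>arcs G. ?q e) = 0" "(\<Sum>v\<in>verts G. \<alpha> v * x v * x v) = 0"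
    by linarith+
  with q p have "\<forall>e\<in>arcs G. ?q e = 0" "\<forall>v\<in>verts G. \<alpha> v * x v * x v = 0"
    by (simp_all add: sum_nonneg_eq_0_iff)
  with length_pos w have edge: "\<And>e. e \<in> arcs G \<Longrightarrow> x (tail G e) = x (head G e)" and "x w = 0"
    by fastforce+
  then have "w \<in> {v \<in> verts G. x v = 0}"
    using w by simp
  with cut[of "{v \<in> verts G. x v = 0}"] edge have "{v \<in> verts G. x v = 0} = verts G"
    by auto
  then show "\<forall>v\<in>verts G. x v = 0"
    by blast
qed

theorem theorem6p1:
  fixes G :: "('v, 'e) pre_digraph" and l :: "'e \<Rightarrow> real" and \<alpha> :: "'v \<Rightarrow> real" and e0 :: 'e
  assumes "connected_metric_graph G l"
    and "torsion_exists G l \<alpha>"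
    and "e0 \<in> arcs G"
  shows "(\<exists>U. open U \<and> l e0 \<in> U \<and> U \<subseteq> {0<..} \<and> rigidity_C1_on G l \<alpha> e0 U)
    \<and> (\<forall>x0\<in>{0..l e0}.
         ((\<lambda>s. torsional_rigidity G (l(e0 := s)) \<alpha>) has_real_derivative
            2 * torsion G l \<alpha> e0 x0 + (edge_deriv l (torsion G l \<alpha>) e0 x0)\<^sup>2) (at (l e0)))
    \<and> (\<forall>x0\<in>{0..l e0}. \<forall>x1\<in>{0..l e0}.
         2 * torsion G l \<alpha> e0 x0 + (edge_deriv l (torsion G l \<alpha>) e0 x0)\<^sup>2 =
         2 * torsion G l \<alpha> e0 x1 + (edge_deriv l (torsion G l \<alpha>) e0 x1)\<^sup>2)
    \<and> ((\<forall>v\<in>verts G. 0 \<le> \<alpha> v) \<and> (\<exists>v\<in>verts G. \<alpha> v \<noteq> 0)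
         \<longrightarrow> rigidity_C1_on G l \<alpha> e0 {0<..})"
proof -
  interpret metric_graph G l
    using assms(1) by (simp add: connected_metric_graph_def)
  note iso = connected_metric_graph_no_isolated_vertex[OF assms(1,3)]
  note C1 = rigidity_C1_on_torsion_exists[OF metric_graph_axioms iso assms(3) refl, of \<alpha>]
  let ?U = "{s. 0 < s \<and> torsion_exists G (l(e0 := s)) \<alpha>}"
  have pos: "0 < l e0"
    using length_pos[OF assms(3)] .
  obtain c where c: "vertex_solution G l \<alpha> c"
    using assms(2) unfolding torsion_exists_def neg_laplacian_one_iff by blast
  have const: "hadamard_density G l \<alpha> e0 x = hadamard_density G l \<alpha> e0 y"
    if "x \<in> {0..l e0}" "y \<in> {0..l e0}" for x y
    using hadamard_density_eq[OF assms(2) c assms(3)] that by simp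
  have "open ?U \<and> l e0 \<in> ?U \<and> ?U \<subseteq> {0<..} \<and> rigidity_C1_on G l \<alpha> e0 ?U"
    using C1 pos assms(2) by auto
  \<comment> \<open>The derivative is known with evaluation point 0; constancy of the density along
    the edge carries it to every \<open>x\<close>.\<close>
  moreover have "((\<lambda>s. torsional_rigidity G (l(e0 := s)) \<alpha>) has_real_derivative
      hadamard_density G l \<alpha> e0 x) (at (l e0))" if "x \<in> {0..l e0}" for x
    using torsion_perturbation(3)[OF iso assms(2,3)] const[OF that, of 0] pos by simp
  moreover have "rigidity_C1_on G l \<alpha> e0 {0<..}"
    if \<alpha>: "(\<forall>v\<in>verts G. 0 \<le> \<alpha> v) \<and> (\<exists>v\<in>verts G. \<alpha> v \<noteq> 0)"
  proof -
    have "torsion_exists G (l(e0 := s)) \<alpha>" if s: "0 < s" for s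
    proof -
      interpret s: metric_graph G "l(e0 := s)"
        using s by (rule metric_graph_fun_upd)
      have "nonsingular G (l(e0 := s)) \<alpha>"
        using nonsingular_if_nonneg[OF s.metric_graph_axioms connected_metric_graph_cut[OF assms(1)]] \<alpha> by blast
      then show ?thesis
        using s.torsion_exists_iff_nonsingular[OF iso] by simp
    qed
    \<comment> \<open>All positive lengths are admissible, so the maximal neighbourhood is the whole
      half-line.\<close>
    then have "?U = {0<..}"
      by auto
    then show ?thesis
      using C1(2) by simp
  qed
  ultimately show ?thesis
    using const unfolding hadamard_density_def by blast
qed

end
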